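(* Let $(M^n,g)$ be a compact connected Riemannian manifold without boundary. There exist $\lambda_0>0$ and $k_g>0$, depending on $(M,g)$, such that for every eigenvalue $\lambda\ge\lambda_0$ of $\Delta_g$ and every real-valued eigenfunction $u_\lambda$ with $\Delta_g u_\lambda=\lambda u_\lambda$ and $\|u_\lambda\|_{L^2(M)}=1$, $$\sum_{i=1}^{|\mathcal A(u_\lambda)|} m_{A_i}\ \le\ k_g\,\lambda^{\frac n2}.$$
   Context: $\Delta_g=-\operatorname{div}_g\nabla_g$ is the (non-negative) Laplace–Beltrami operator. A nodal domain of $u_\lambda$ is a maximal connected open subset of $\{u_\lambda\neq0\}$; $\mathcal A(u_\lambda)=\{A_i\}$ is the (finite) collection of all nodal domains of $u_\lambda$, $|\mathcal A(u_\lambda)|$ its cardinality, and $m_{A_i}=\max_{x\in A_i}|u_\lambda(x)|$. *)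

theory Defs
  imports "HOL-Analysis.Analysis"
begin

fun Ck_on :: "nat \<Rightarrow> 'b::real_normed_vector set \<Rightarrow> ('b \<Rightarrow> 'c::real_normed_vector) \<Rightarrow> bool" where
  "Ck_on 0 S f \<longleftrightarrow> continuous_on S f"
| "Ck_on (Suc k) S f \<longleftrightarrow> (\<forall>x\<in>S. f differentiable (at x)) \<and>
     (\<forall>v. Ck_on k S (\<lambda>x. frechet_derivative f (at x) v))"

text \<open>Only used for open sets in finite-dimensional spaces.\<close>

definition smooth_on :: "'b::real_normed_vector set \<Rightarrow> ('b \<Rightarrow> 'c::real_normed_vector) \<Rightarrow> bool" where
  "smooth_on S f \<longleftrightarrow> (\<forall>k. Ck_on k S f)"

definition partial :: "'n::finite \<Rightarrow> (real^'n \<Rightarrow> real) \<Rightarrow> real^'n \<Rightarrow> real" where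
  "partial i f x = frechet_derivative f (at x) (axis i 1)"

text \<open>A chart is a pair of its domain and its coordinate map; the value of the coordinate map
  outside the domain is irrelevant. Manifolds are subsets of a type, with the subspace topology;
  no ambient differentiable structure is used.\<close>

type_synonym ('a, 'n) chart = "'a set \<times> ('a \<Rightarrow> real^'n)"

definition chart_image :: "('a, 'n::finite) chart \<Rightarrow> (real^'n) set" where
  "chart_image c = snd c ` fst c"

definition chart_inv :: "('a, 'n::finite) chart \<Rightarrow> real^'n \<Rightarrow> 'a" where
  "chart_inv c = inv_into (fst c) (snd c)"

definition chart_on :: "'a::t2_space set \<Rightarrow> ('a, 'n::finite) chart \<Rightarrow> bool" where
  "chart_on M c \<longleftrightarrow> openin (top_of_set M) (fst c) \<and> open (chart_image c) \<and>
     homeomorphism (fst c) (chart_image c) (snd c) (chart_inv c)"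

definition overlap :: "('a, 'n::finite) chart \<Rightarrow> ('a, 'n) chart \<Rightarrow> (real^'n) set" where
  "overlap c d = snd c ` (fst c \<inter> fst d)"

definition transition :: "('a, 'n::finite) chart \<Rightarrow> ('a, 'n) chart \<Rightarrow> real^'n \<Rightarrow> real^'n" where
  "transition c d = snd d \<circ> chart_inv c"

locale smooth_manifold =
  fixes M :: "'a::t2_space set" and \<A> :: "('a, 'n::finite) chart set"
  assumes second_countable: "second_countable (top_of_set M)"
    and charts: "c \<in> \<A> \<Longrightarrow> chart_on M c"
    and cover: "(\<Union>c\<in>\<A>. fst c) = M"
    and compatible: "c \<in> \<A> \<Longrightarrow> d \<in> \<A> \<Longrightarrow> smooth_on (overlap c d) (transition c d)"

text \<open>\<open>g c x\<close> is the Gram matrix of the metric in the coordinate basis of the chart \<open>c\<close>, at the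
  point of the manifold with coordinates \<open>x\<close>; \<open>covariant\<close> is the transformation law of a
  (0,2)-tensor.\<close>

locale riemannian_manifold = smooth_manifold M \<A>
  for M :: "'a::t2_space set" and \<A> :: "('a, 'n::finite) chart set" +
  fixes g :: "('a, 'n) chart \<Rightarrow> real^'n \<Rightarrow> real^'n^'n"
  assumes smooth: "c \<in> \<A> \<Longrightarrow> smooth_on (chart_image c) (g c)"
    and symmetric: "c \<in> \<A> \<Longrightarrow> x \<in> chart_image c \<Longrightarrow> transpose (g c x) = g c x"
    and positive_definite: "c \<in> \<A> \<Longrightarrow> x \<in> chart_image c \<Longrightarrow> v \<noteq> 0 \<Longrightarrow> v \<bullet> (g c x *v v) > 0"
    and covariant: "c \<in> \<A> \<Longrightarrow> d \<in> \<A> \<Longrightarrow> x \<in> overlap c d \<Longrightarrow>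
      J = matrix (frechet_derivative (transition c d) (at x)) \<Longrightarrow>
      g c x = transpose J ** g d (transition c d x) ** J"

definition volume_density ::
  "(('a, 'n::finite) chart \<Rightarrow> real^'n \<Rightarrow> real^'n^'n) \<Rightarrow> ('a, 'n) chart \<Rightarrow> real^'n \<Rightarrow> real" where
  "volume_density g c x = sqrt (det (g c x))"

text \<open>The measure \<open>volume_density g c x dx\<close> of a chart, pushed forward to \<open>M\<close>
  (zero outside the chart).\<close>

definition chart_volume ::
  "'a::t2_space set \<Rightarrow> (('a, 'n::finite) chart \<Rightarrow> real^'n \<Rightarrow> real^'n^'n) \<Rightarrow> ('a, 'n) chart \<Rightarrow> 'a measure" where
  "chart_volume M g c =
     distr (density (restrict_space lborel (chart_image c)) (\<lambda>x. ennreal (volume_density g c x)))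
       (restrict_space borel M) (chart_inv c)"

text \<open>By the change of variables formula and the transformation law of \<open>g\<close>, the chart measures
  agree on overlaps. Their least upper bound in the lattice of measures is therefore the measure
  glued from them: the unique Borel measure on \<open>M\<close> that restricts to
  \<open>volume_density g c x dx\<close> on the domain of every chart \<open>c\<close>.\<close>

definition riemannian_volume ::
  "'a::t2_space set \<Rightarrow> ('a, 'n::finite) chart set \<Rightarrow> (('a, 'n) chart \<Rightarrow> real^'n \<Rightarrow> real^'n^'n) \<Rightarrow> 'a measure" where
  "riemannian_volume M \<A> g = (SUP c\<in>\<A>. chart_volume M g c)"

definition smooth_function :: "('a, 'n::finite) chart set \<Rightarrow> ('a \<Rightarrow> real) \<Rightarrow> bool" where
  "smooth_function \<A> u \<longleftrightarrow> (\<forall>c\<in>\<A>. smooth_on (chart_image c) (u \<circ> chart_inv c))"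

text \<open>Gradient, divergence and Laplacian in the coordinates of a chart: with \<open>G = g c x\<close>,
  the gradient has components \<open>\<Sum>j. G\<^sup>i\<^sup>j \<partial>\<^sub>j u\<close>, and the divergence of \<open>X\<close> is
  \<open>(det G)\<^sup>-\<^sup>1\<^sup>/\<^sup>2 \<Sum>i. \<partial>\<^sub>i ((det G)\<^sup>1\<^sup>/\<^sup>2 X\<^sup>i)\<close>. These expressions are invariant under changes of
  coordinates.\<close>

definition gradient ::
  "(('a, 'n::finite) chart \<Rightarrow> real^'n \<Rightarrow> real^'n^'n) \<Rightarrow> ('a, 'n) chart \<Rightarrow> ('a \<Rightarrow> real) \<Rightarrow> real^'n \<Rightarrow> real^'n" where
  "gradient g c u x = matrix_inv (g c x) *v (\<chi> j. partial j (u \<circ> chart_inv c) x)"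

definition divergence ::
  "(('a, 'n::finite) chart \<Rightarrow> real^'n \<Rightarrow> real^'n^'n) \<Rightarrow> ('a, 'n) chart \<Rightarrow> (real^'n \<Rightarrow> real^'n) \<Rightarrow> real^'n \<Rightarrow> real" where
  "divergence g c X x =
     (\<Sum>i\<in>UNIV. partial i (\<lambda>y. volume_density g c y * X y $ i) x) / volume_density g c x"

definition laplacian ::
  "(('a, 'n::finite) chart \<Rightarrow> real^'n \<Rightarrow> real^'n^'n) \<Rightarrow> ('a, 'n) chart \<Rightarrow> ('a \<Rightarrow> real) \<Rightarrow> real^'n \<Rightarrow> real" where
  "laplacian g c u x = - divergence g c (gradient g c u) x"

definition eigenfunction ::
  "'a::t2_space set \<Rightarrow> ('a, 'n::finite) chart set \<Rightarrow> (('a, 'n) chart \<Rightarrow> real^'n \<Rightarrow> real^'n^'n) \<Rightarrow>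
    real \<Rightarrow> ('a \<Rightarrow> real) \<Rightarrow> bool" where
  "eigenfunction M \<A> g \<mu> u \<longleftrightarrow> smooth_function \<A> u \<and> (\<exists>p\<in>M. u p \<noteq> 0) \<and>
     (\<forall>c\<in>\<A>. \<forall>p\<in>fst c. laplacian g c u (snd c p) = \<mu> * u p)"

definition eigenvalue ::
  "'a::t2_space set \<Rightarrow> ('a, 'n::finite) chart set \<Rightarrow> (('a, 'n) chart \<Rightarrow> real^'n \<Rightarrow> real^'n^'n) \<Rightarrow>
    real \<Rightarrow> bool" where
  "eigenvalue M \<A> g \<mu> \<longleftrightarrow> (\<exists>u. eigenfunction M \<A> g \<mu> u)"

definition l2_norm :: "'a measure \<Rightarrow> ('a \<Rightarrow> real) \<Rightarrow> real" where
  "l2_norm \<nu> u = sqrt (\<integral>p. (u p)\<^sup>2 \<partial>\<nu>)"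

definition nodal_domains :: "'a::t2_space set \<Rightarrow> ('a \<Rightarrow> real) \<Rightarrow> 'a set set" where
  "nodal_domains M u =
    (let P = (\<lambda>A. A \<noteq> {} \<and> openin (top_of_set M) A \<and> connected A \<and> (\<forall>p\<in>A. u p \<noteq> 0))
     in {A. P A \<and> (\<forall>B. P B \<and> A \<subseteq> B \<longrightarrow> B = A)})"

text \<open>For a nodal domain \<open>A\<close> of a continuous function on a compact manifold, the supremum is
  attained: \<open>\<bar>u\<bar>\<close> has a maximum on the compact closure of \<open>A\<close>, and \<open>u\<close> vanishes on the boundary
  of \<open>A\<close>.\<close>

definition nodal_max :: "('a \<Rightarrow> real) \<Rightarrow> 'a set \<Rightarrow> real" where
  "nodal_max u A = (SUP p\<in>A. \<bar>u p\<bar>)"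

end

theory Submission
  imports Defs
begin

text \<open>The boundary of a nodal domain may be irregular, so no boundary integral is taken over
  it; a high power of \<open>u\<close> makes the truncation regular instead. The flux of
  \<open>w\<close> is \<open>4 u\<^sup>3\<close> times that of \<open>u\<close>, and the truncated
  cube is already \<open>C\<^sup>1\<close>; this singles out the exponent 4, and the even power
  makes \<open>w\<close> nonnegative whatever the sign of \<open>u\<close> on \<open>A\<close>.

  Two errors determine the constants. With \<open>s = \<epsilon> \<mu> powr (-1/2)\<close> the
  eigenvalue term has relative size \<open>\<mu> s\<^sup>2 = \<epsilon>\<^sup>2\<close>, which a
  fixed \<open>\<epsilon>\<close> makes small for all \<mu> at once. The error from freezing the
  coefficients has relative size \<open>s\<close> and is small only below a fixed radius: hence the
  threshold on \<mu>. The factor \<open>\<mu> powr (n/2)\<close> is the normalization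
  \<open>s powr (-n)\<close> of the averages. Finally \<open>w\<close> is at most the cube of the
  maximum times \<open>\<bar>u\<bar>\<close>, and division by this cube turns an estimate of fourth
  powers into one that is linear in \<open>\<bar>u\<bar>\<close> and can be added over disjoint
  domains.\<close>

text \<open>On a nodal domain \<open>A\<close> of an eigenfunction \<open>u\<close> let \<open>w = u\<^sup>4\<close> on \<open>A\<close> and \<open>w = 0\<close> elsewhere.
  In a chart, with \<open>b = sqrt (det G)\<close> and \<open>a = b G\<^sup>-\<^sup>1\<close>, the function \<open>w\<close> and its flux
  \<open>a \<nabla>w\<close> are \<open>C\<^sup>1\<close> across the boundary of \<open>A\<close>, and \<open>div (a \<nabla>w) \<ge> - 4 \<mu> b w\<close>. Let
  \<open>\<bar>u\<bar>\<close> attain its maximum over \<open>A\<close> at \<open>x0\<close>. The averages of \<open>w\<close> over ellipsoids of size \<open>s\<close>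
  about \<open>x0\<close>, adapted to \<open>G x0\<close>, have \<open>s\<close>-derivative at least \<open>- const w(x0) (1 + \<mu> s)\<close>:
  freezing the coefficients at \<open>x0\<close> costs only a term of order \<open>w(x0)\<close>, which is harmless
  because \<open>w(x0)\<close> is the maximum of \<open>w\<close>. Taking \<open>s\<close> a small multiple of \<open>\<mu> powr (-1/2)\<close> gives
  \<open>max\<^bsub>A\<^esub> \<bar>u\<bar> \<le> C \<mu> powr (n/2) \<integral> \<bar>u\<bar>\<close>, integrating over a coordinate piece of \<open>A\<close>.
  Summing over the disjoint nodal domains and over finitely many charts yields the sum bound;
  bounding \<open>\<bar>u\<bar>\<close> by its maximum on the right-hand side and dividing by it yields finiteness.

  All integrals are taken in coordinates, so the Riemannian volume enters only through the
  fact that it dominates every chart volume; no change of variables is needed.\<close>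

section \<open>Continuously differentiable functions and matrices\<close>

text \<open>The Euclidean gradient in coordinates. The Riemannian \<open>gradient\<close> is
  obtained from it by applying \<open>matrix_inv (g c x)\<close>.\<close>

definition grad :: "(real^'n \<Rightarrow> real) \<Rightarrow> real^'n \<Rightarrow> real^'n::finite" where
  "grad f x = (\<chi> i. partial i f x)"

text \<open>The derivative is taken at \<open>x\<close> in the whole space, not within
  \<open>S\<close>. Restriction to any subset is therefore immediate, and the notion can be used on
  compact subsets of an open domain.\<close>

definition C1_on :: "(real^'n) set \<Rightarrow> (real^'n::finite \<Rightarrow> real) \<Rightarrow> bool" where
  "C1_on S f \<longleftrightarrow> (\<exists>f'. (\<forall>x\<in>S. (f has_derivative inner (f' x)) (at x)) \<and> continuous_on S f')"

lemma linear_real_eq_inner: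
  fixes L :: "real^'n::finite \<Rightarrow> real"
  assumes "linear L"
  shows "L = inner (\<chi> i. L (axis i 1))"
proof
  fix v :: "real^'n"
  have "L v = L (\<Sum>i\<in>UNIV. (v $ i) *\<^sub>R axis i 1)"
    using basis_expansion[of v] by (simp add: scalar_mult_eq_scaleR)
  also have "\<dots> = (\<Sum>i\<in>UNIV. v $ i * L (axis i 1))"
    using assms by (simp add: linear_sum linear_cmul)
  finally show "L v = (\<chi> i. L (axis i 1)) \<bullet> v"
    by (simp add: inner_vec_def mult.commute)
qed

lemma has_derivative_grad:
  assumes "f differentiable (at x)"
  shows "(f has_derivative inner (grad f x)) (at x)"
proof -
  have "(f has_derivative frechet_derivative f (at x)) (at x)"
    using assms by (simp add: frechet_derivative_works)
  moreover have "frechet_derivative f (at x) = inner (grad f x)"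
    using linear_real_eq_inner[OF linear_frechet_derivative[OF assms]]
    by (simp add: grad_def partial_def)
  ultimately show ?thesis by simp
qed

lemma grad_unique:
  assumes "(f has_derivative inner v) (at x)"
  shows "grad f x = v"
  unfolding grad_def partial_def frechet_derivative_at[OF assms, symmetric]
  by (simp add: vec_eq_iff inner_axis)

lemma C1_on_grad:
  assumes "C1_on S f"
  shows "\<And>x. x \<in> S \<Longrightarrow> (f has_derivative inner (grad f x)) (at x)" "continuous_on S (grad f)"
proof -
  obtain f' where f': "\<forall>x\<in>S. (f has_derivative inner (f' x)) (at x)" "continuous_on S f'"
    using assms unfolding C1_on_def by blast
  have eq: "grad f x = f' x" if "x \<in> S" for x
    using f' that grad_unique by blast
  show "(f has_derivative inner (grad f x)) (at x)" if "x \<in> S" for x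
    using eq f' that by simp
  show "continuous_on S (grad f)"
    using f'(2) eq continuous_on_cong by metis
qed

lemma C1_onI:
  assumes "\<And>x. x \<in> S \<Longrightarrow> (f has_derivative inner (f' x)) (at x)" "continuous_on S f'"
  shows "C1_on S f"
  using assms unfolding C1_on_def by blast

lemma C1_on_continuous: "C1_on S f \<Longrightarrow> continuous_on S f"
  by (meson C1_on_grad(1) continuous_at_imp_continuous_on has_derivative_continuous)

lemma C1_on_const: "C1_on S (\<lambda>x. c)"
  by (rule C1_onI[where f'="\<lambda>x. 0"]) (auto intro!: derivative_eq_intros)

lemma C1_on_component: "C1_on S (\<lambda>x. x $ i)"
proof (rule C1_onI)
  have "(\<bullet>) (axis i 1) = (\<lambda>x::real^'a. x $ i)"
    by (auto simp: inner_axis')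
  then show "((\<lambda>x. x $ i) has_derivative (\<bullet>) (axis i 1)) (at x)" for x :: "real^'a"
    using bounded_linear.has_derivative[OF bounded_linear_vec_nth has_derivative_ident, of i "at x"] by simp
qed simp

lemma C1_on_add:
  assumes "C1_on S f" "C1_on S g" shows "C1_on S (\<lambda>x. f x + g x)"
  using C1_on_grad[OF assms(1)] C1_on_grad[OF assms(2)]
  by (intro C1_onI[where f'="\<lambda>x. grad f x + grad g x"])
     (auto intro!: derivative_eq_intros continuous_intros simp: inner_left_distrib)

lemma C1_on_mult:
  assumes "C1_on S f" "C1_on S g" shows "C1_on S (\<lambda>x. f x * g x)"
  using C1_on_grad[OF assms(1)] C1_on_grad[OF assms(2)] assms[THEN C1_on_continuous]
  by (intro C1_onI[where f'="\<lambda>x. f x *\<^sub>R grad g x + g x *\<^sub>R grad f x"])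
     (auto intro!: derivative_eq_intros continuous_intros simp: inner_left_distrib)

lemma C1_on_minus: "C1_on S f \<Longrightarrow> C1_on S (\<lambda>x. - f x)"
  using C1_on_mult[OF C1_on_const[of S "-1"], of f] by simp

lemma C1_on_diff: "C1_on S f \<Longrightarrow> C1_on S g \<Longrightarrow> C1_on S (\<lambda>x. f x - g x)"
  using C1_on_add[OF _ C1_on_minus, of S f g] by simp

lemma C1_on_sum: "(\<And>i. i \<in> I \<Longrightarrow> C1_on S (f i)) \<Longrightarrow> C1_on S (\<lambda>x. \<Sum>i\<in>I. f i x)"
  by (induction I rule: infinite_finite_induct) (auto intro: C1_on_const C1_on_add)

lemma C1_on_prod: "(\<And>i. i \<in> I \<Longrightarrow> C1_on S (f i)) \<Longrightarrow> C1_on S (\<lambda>x. \<Prod>i\<in>I. f i x)"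
  by (induction I rule: infinite_finite_induct) (auto intro: C1_on_const C1_on_mult)

lemma C1_on_compose_real:
  assumes f: "C1_on S f" and h: "\<And>x. x \<in> S \<Longrightarrow> (h has_real_derivative h' (f x)) (at (f x))"
    and c: "continuous_on (f ` S) h'"
  shows "C1_on S (\<lambda>x. h (f x))"
proof (rule C1_onI[where f'="\<lambda>x. h' (f x) *\<^sub>R grad f x"])
  show "((\<lambda>x. h (f x)) has_derivative (\<bullet>) (h' (f x) *\<^sub>R grad f x)) (at x)" if "x \<in> S" for x
    using has_derivative_compose[OF C1_on_grad(1)[OF f that] h[OF that, unfolded has_field_derivative_def]]
    by (rule has_derivative_eq_rhs) auto
  show "continuous_on S (\<lambda>x. h' (f x) *\<^sub>R grad f x)"
    using C1_on_continuous[OF f] C1_on_grad(2)[OF f] c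
    by (intro continuous_intros) (auto intro: continuous_on_compose2)
qed

lemma C1_on_inverse:
  assumes f: "C1_on S f" and nz: "\<And>x. x \<in> S \<Longrightarrow> f x \<noteq> 0"
  shows "C1_on S (\<lambda>x. inverse (f x))"
proof (rule C1_on_compose_real[OF f])
  show "(inverse has_real_derivative - (inverse (f x) * inverse (f x))) (at (f x))" if "x \<in> S" for x
    using DERIV_inverse'[OF DERIV_ident nz[OF that]] by simp
  show "continuous_on (f ` S) (\<lambda>t. - (inverse t * inverse t))"
    by (intro continuous_on_minus continuous_on_mult continuous_on_inverse continuous_on_id) (use nz in auto)
qed

lemma C1_on_sqrt:
  assumes f: "C1_on S f" and pos: "\<And>x. x \<in> S \<Longrightarrow> f x > 0"
  shows "C1_on S (\<lambda>x. sqrt (f x))"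
proof (rule C1_on_compose_real[OF f])
  show "(sqrt has_real_derivative inverse (sqrt (f x)) / 2) (at (f x))" if "x \<in> S" for x
    by (rule DERIV_real_sqrt[OF pos[OF that]])
  show "continuous_on (f ` S) (\<lambda>t. inverse (sqrt t) / 2)"
    using pos by (intro continuous_on_divide continuous_on_inverse continuous_on_real_sqrt
        continuous_on_id continuous_on_const) fastforce+
qed

lemma C1_on_det:
  fixes A :: "real^'n::finite \<Rightarrow> real^'a^'a::finite"
  assumes "\<And>i j. C1_on S (\<lambda>x. A x $ i $ j)"
  shows "C1_on S (\<lambda>x. det (A x))"
proof -
  have "C1_on S (\<lambda>x. \<Prod>i\<in>UNIV. A x $ i $ p i)" for p :: "'a \<Rightarrow> 'a"
    by (rule C1_on_prod[OF assms])
  then have "C1_on S (\<lambda>x. of_int (sign p) * (\<Prod>i\<in>UNIV. A x $ i $ p i))" for p :: "'a \<Rightarrow> 'a"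
    by (rule C1_on_mult[OF C1_on_const])
  then show ?thesis
    unfolding det_def by (rule C1_on_sum)
qed

lemma C1_on_cong:
  assumes "open S" "C1_on S f" "\<And>x. x \<in> S \<Longrightarrow> f x = g x"
  shows "C1_on S g"
proof (rule C1_onI[where f'="grad f"])
  show "(g has_derivative (\<bullet>) (grad f x)) (at x)" if "x \<in> S" for x
    by (rule has_derivative_transform_within_open[OF C1_on_grad(1)[OF assms(2) that] assms(1) that assms(3)])
qed (rule C1_on_grad(2)[OF assms(2)])

lemma C1_on_subset: "C1_on S f \<Longrightarrow> T \<subseteq> S \<Longrightarrow> C1_on T f"
  unfolding C1_on_def by (meson continuous_on_subset subsetD)

section \<open>Determinants and inverses of matrix functions\<close>

lemma mat_mult_matrix_inv:
  fixes A :: "real^'n^'n::finite"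
  assumes "det A \<noteq> 0"
  shows "A ** matrix_inv A = mat 1"
  using assms someI_ex[of "\<lambda>B. A ** B = mat 1 \<and> B ** A = mat 1"]
  unfolding invertible_det_nz[symmetric] invertible_def matrix_inv_def by blast

text \<open>Cramer's rule applied to the columns of the inverse. Quotients of determinants are
  polynomial expressions divided by a nonvanishing one, and in this form differentiability passes to
  the inverse.\<close>

lemma matrix_inv_component:
  fixes A :: "real^'n^'n::finite"
  assumes "det A \<noteq> 0"
  shows "matrix_inv A $ k $ j = det (\<chi> p q. if q = k then axis j 1 $ p else A $ p $ q) / det A"
proof -
  have "A *v (matrix_inv A *v axis j 1) = axis j 1"
    using assms by (simp add: matrix_vector_mul_assoc mat_mult_matrix_inv)
  then have "matrix_inv A *v axis j 1 =
      (\<chi> k. det (\<chi> p q. if q = k then axis j 1 $ p else A $ p $ q) / det A)"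
    using cramer[OF assms] by blast
  then show ?thesis
    by (simp add: vec_eq_iff matrix_vector_mult_basis column_def)
qed

lemma C1_on_matrix_inv:
  fixes A :: "real^'n \<Rightarrow> real^'n^'n::finite"
  assumes "open S" and A: "\<And>i j. C1_on S (\<lambda>x. A x $ i $ j)" and nz: "\<And>x. x \<in> S \<Longrightarrow> det (A x) \<noteq> 0"
  shows "C1_on S (\<lambda>x. matrix_inv (A x) $ i $ j)"
proof (rule C1_on_cong[OF \<open>open S\<close>])
  show "C1_on S (\<lambda>x. det (\<chi> p q. if q = i then axis j 1 $ p else A x $ p $ q) * inverse (det (A x)))"
  proof (intro C1_on_mult C1_on_inverse C1_on_det A nz)
    fix p q
    show "C1_on S (\<lambda>x. (\<chi> p q. if q = i then axis j 1 $ p else A x $ p $ q) $ p $ q)"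
      by (cases "q = i") (auto intro: C1_on_const A)
  qed
qed (use matrix_inv_component[OF nz] in \<open>simp add: divide_inverse\<close>)

text \<open>The segment from the identity to \<open>A\<close> consists of positive definite, hence
  invertible, matrices, so the determinant cannot change sign along it.\<close>

lemma det_pos_definite:
  fixes A :: "real^'n^'n::finite"
  assumes "\<And>v. v \<noteq> 0 \<Longrightarrow> v \<bullet> (A *v v) > 0"
  shows "det A > 0"
proof (rule ccontr)
  assume "\<not> det A > 0"
  define B where "B t = (1 - t) *\<^sub>R mat 1 + t *\<^sub>R A" for t :: real
  have nz: "det (B t) \<noteq> 0" if "t \<in> {0..1}" for t
  proof
    assume "det (B t) = 0"
    then have "\<not> (\<exists>C. C ** B t = mat 1)"
      by (simp flip: invertible_left_inverse add: invertible_det_nz)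
    then obtain v where v: "v \<noteq> 0" "B t *v v = 0"
      by (auto simp: matrix_left_invertible_ker)
    have "v \<bullet> (B t *v v) = (1 - t) * (v \<bullet> v) + t * (v \<bullet> (A *v v))"
      by (simp add: B_def matrix_vector_mult_add_rdistrib inner_add_right
          scaleR_matrix_vector_assoc[symmetric])
    moreover have "\<dots> > 0"
    proof (cases "t = 0")
      case False
      then have "t * (v \<bullet> (A *v v)) > 0" using assms[OF v(1)] that by simp
      then show ?thesis using that by (simp add: add_nonneg_pos)
    qed (use v in simp)
    ultimately show False using v by simp
  qed
  have "continuous_on {0..1} (\<lambda>t. det (B t))"
    unfolding det_def B_def by (intro continuous_intros)
  moreover have "det (B 1) \<le> 0" "det (B 0) \<ge> 0" using \<open>\<not> det A > 0\<close> by (auto simp: B_def)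
  ultimately obtain t where "0 \<le> t" "t \<le> 1" "det (B t) = 0"
    using IVT2'[of "\<lambda>t. det (B t)" 1 0 0] by auto
  then show False using nz by auto
qed

section \<open>From iterated differentiability to \<open>C1_on\<close>\<close>

lemma C1_on_if_Ck_on:
  assumes "Ck_on (Suc k) S f" shows "C1_on S f"
proof (rule C1_onI[where f'="grad f"])
  show "(f has_derivative (\<bullet>) (grad f x)) (at x)" if "x \<in> S" for x
    using assms that has_derivative_grad by auto
  have "continuous_on S (\<lambda>x. frechet_derivative f (at x) v)" for v
  \<comment> \<open>Only \<open>Ck_on 0\<close> speaks of continuity. At higher orders the
    directional derivatives are continuous because they are differentiable.\<close>
  proof (cases k)
    case (Suc l)
    then show ?thesis using assms
      by (auto intro!: continuous_at_imp_continuous_on differentiable_imp_continuous_within)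
  qed (use assms in simp)
  then show "continuous_on S (grad f)"
    unfolding grad_def partial_def by (intro continuous_intros)
qed

lemma C1_on_partial_if_Ck_on:
  assumes "Ck_on (Suc (Suc k)) S f" shows "C1_on S (partial i f)"
  using C1_on_if_Ck_on[of k S "\<lambda>x. frechet_derivative f (at x) (axis i 1)"] assms
  by (simp add: partial_def[abs_def])

text \<open>Serves to pass from the matrix-valued metric to its entries.\<close>

lemma Ck_on_bounded_linear:
  fixes f :: "'b::real_normed_vector \<Rightarrow> 'c::real_normed_vector" and h :: "'c \<Rightarrow> 'd::real_normed_vector"
  assumes h: "bounded_linear h" and f: "Ck_on 1 S f"
  shows "Ck_on (Suc 0) S (\<lambda>x. h (f x))"
proof -
  have D: "((\<lambda>x. h (f x)) has_derivative (\<lambda>v. h (frechet_derivative f (at x) v))) (at x)" if "x \<in> S" for x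
    using f that by (intro bounded_linear.has_derivative[OF h]) (simp add: frechet_derivative_works)
  have "continuous_on S (\<lambda>x. frechet_derivative (\<lambda>x. h (f x)) (at x) v)" for v
  proof (rule continuous_on_eq)
    show "continuous_on S (\<lambda>x. h (frechet_derivative f (at x) v))"
      using f by (intro bounded_linear.continuous_on[OF h]) simp
  qed (simp add: frechet_derivative_at[OF D, symmetric])
  with D show ?thesis by (auto simp: differentiable_def)
qed

section \<open>Integration by parts with compact support\<close>

text \<open>Differentiate the constant \<open>\<integral> \<phi>(x + t e) dx\<close> at \<open>t = 0\<close>.\<close>

lemma has_integral_directional_derivative_global:
  fixes \<phi> :: "real^'n::finite \<Rightarrow> real"
  assumes D: "\<And>x. (\<phi> has_derivative inner (\<phi>' x)) (at x)" and c: "continuous_on UNIV \<phi>'"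
    and S: "bounded S" and supp: "\<And>x. x \<notin> S \<Longrightarrow> \<phi> x = 0" "\<And>x. x \<notin> S \<Longrightarrow> \<phi>' x \<bullet> e = 0"
  shows "((\<lambda>x. \<phi>' x \<bullet> e) has_integral 0) UNIV"
proof -
  have cont: "continuous_on UNIV \<phi>"
    by (meson D continuous_at_imp_continuous_on has_derivative_continuous)
  obtain B where B: "\<And>x. x \<in> S \<Longrightarrow> norm x \<le> B"
    using S bounded_iff by metis
  obtain a where a: "cball 0 (B + norm e) \<subseteq> cbox (-a) (a::real^'n)"
    using bounded_cball bounded_subset_cbox_symmetric by blast
  \<comment> \<open>The box is fixed and contains every translate of the support with
    \<open>\<bar>t\<bar> \<le> 1\<close>. So the Leibniz rule on a compact box applies, although
    \<open>J t\<close> equals an integral over the whole space.\<close>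
  define J where "J t = integral (cbox (-a) a) (\<lambda>x. \<phi> (x + t *\<^sub>R e))" for t :: real
  have J0: "J t = integral UNIV \<phi>" if "t \<in> {-1..1}" for t
  proof -
    have sub: "\<phi> (x + s *\<^sub>R e) = 0" if "x \<notin> cbox (-a) a" "s \<in> {-1..1}" for x s
    proof (rule supp(1), rule notI)
      assume "x + s *\<^sub>R e \<in> S"
      then have "norm (x + s *\<^sub>R e) \<le> B" by (rule B)
      moreover have "norm x \<le> norm (x + s *\<^sub>R e) + norm (s *\<^sub>R e)"
        by (metis add_diff_cancel_right' norm_triangle_ineq4)
      moreover have "norm (s *\<^sub>R e) \<le> norm e"
        using that(2) by (simp add: abs_le_iff mult_left_le_one_le)
      ultimately have "x \<in> cball 0 (B + norm e)" by simp
      then show False using a that(1) by blast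
    qed
    have int: "(\<phi> has_integral integral (cbox (-a) a) \<phi>) (cbox (-a) a)"
      by (intro integrable_integral integrable_continuous continuous_on_subset[OF cont]) simp
    have I: "(\<phi> has_integral integral (cbox (-a) a) \<phi>) UNIV"
      by (rule has_integral_on_superset[OF int]) (use sub[of _ 0] in auto)
    then have eq: "integral UNIV \<phi> = integral (cbox (-a) a) \<phi>"
      by (rule integral_unique)
    have "((\<lambda>x. \<phi> (1 *\<^sub>R x + t *\<^sub>R e)) has_integral integral (cbox (-a) a) \<phi> /\<^sub>R 1 ^ DIM(real^'n))
        (cbox ((-a - t *\<^sub>R e) /\<^sub>R 1) ((a - t *\<^sub>R e) /\<^sub>R 1))"
      by (rule has_integral_affinity'[OF int]) simp
    then have int2: "((\<lambda>x. \<phi> (x + t *\<^sub>R e)) has_integral integral (cbox (-a) a) \<phi>)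
        (cbox (-a - t *\<^sub>R e) (a - t *\<^sub>R e))" by simp
    have "((\<lambda>x. \<phi> (x + t *\<^sub>R e)) has_integral integral (cbox (-a) a) \<phi>) UNIV"
    proof (rule has_integral_on_superset[OF int2])
      show "\<phi> (x + t *\<^sub>R e) = 0" if "x \<notin> cbox (-a - t *\<^sub>R e) (a - t *\<^sub>R e)" for x
      proof -
        have "x + t *\<^sub>R e \<notin> cbox (-a) a"
          using that by (auto simp: mem_box algebra_simps inner_diff_left inner_add_left)
        then show ?thesis using sub[of _ 0] by simp
      qed
    qed simp
    moreover have "((\<lambda>x. \<phi> (x + t *\<^sub>R e)) has_integral J t) UNIV"
    proof (rule has_integral_on_superset)
      show "((\<lambda>x. \<phi> (x + t *\<^sub>R e)) has_integral J t) (cbox (-a) a)"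
        unfolding J_def
        by (intro integrable_integral integrable_continuous continuous_on_compose2[OF cont] continuous_intros) auto
    qed (use sub[OF _ that] in auto)
    ultimately show ?thesis using eq has_integral_unique by metis
  qed
  have "(J has_field_derivative integral (cbox (-a) a) (\<lambda>x. \<phi>' (x + 0 *\<^sub>R e) \<bullet> e)) (at 0 within {-1..1})"
    unfolding J_def
  proof (rule leibniz_rule_field_derivative)
    show "((\<lambda>t. \<phi> (x + t *\<^sub>R e)) has_field_derivative \<phi>' (x + t *\<^sub>R e) \<bullet> e) (at t within {-1..1})" for t x
    proof -
      have "((\<lambda>t. x + t *\<^sub>R e) has_derivative (\<lambda>h. h *\<^sub>R e)) (at t within {-1..1})"
        by (auto intro!: derivative_eq_intros)
      then have "((\<lambda>t. \<phi> (x + t *\<^sub>R e)) has_derivative (\<lambda>h. \<phi>' (x + t *\<^sub>R e) \<bullet> (h *\<^sub>R e))) (at t within {-1..1})"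
        by (rule has_derivative_compose[OF _ D])
      then show ?thesis
        by (rule has_derivative_imp_has_field_derivative) simp
    qed
    show "(\<lambda>x. \<phi> (x + t *\<^sub>R e)) integrable_on cbox (- a) a" for t
      by (intro integrable_continuous continuous_on_compose2[OF cont] continuous_intros) auto
    show "continuous_on ({-1..1} \<times> cbox (- a) a) (\<lambda>(t, x). \<phi>' (x + t *\<^sub>R e) \<bullet> e)"
      unfolding split_def by (intro continuous_on_compose2[OF c] continuous_intros) auto
  qed auto
  then have "(J has_field_derivative integral (cbox (-a) a) (\<lambda>x. \<phi>' x \<bullet> e)) (at 0)"
    using at_within_Icc_at[of "-1::real" 0 1] by simp
  moreover have "(J has_field_derivative 0) (at 0)"
  proof (rule DERIV_cong_ev[THEN iffD1, OF refl _ refl, rotated])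
    show "((\<lambda>t. integral UNIV \<phi>) has_field_derivative 0) (at 0)" by simp
    have "eventually (\<lambda>t::real. t \<in> {-1<..<1}) (nhds 0)"
      by (intro eventually_nhds_in_open) auto
    then show "\<forall>\<^sub>F t in nhds 0. integral UNIV \<phi> = J t"
      by eventually_elim (simp add: J0)
  qed
  ultimately have "integral (cbox (-a) a) (\<lambda>x. \<phi>' x \<bullet> e) = 0"
    by (rule DERIV_unique)
  moreover have "(\<lambda>x. \<phi>' x \<bullet> e) integrable_on cbox (-a) a"
    by (intro integrable_continuous continuous_intros continuous_on_subset[OF c]) auto
  ultimately have "((\<lambda>x. \<phi>' x \<bullet> e) has_integral 0) (cbox (-a) a)"
    by (metis has_integral_integral)
  then show ?thesis
  proof (rule has_integral_on_superset)
    show "\<phi>' x \<bullet> e = 0" if "x \<notin> cbox (-a) a" for x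
      using supp(2)[of x] B[of x] a that by (force simp: subset_eq intro: order_trans)
  qed simp
qed

text \<open>Extension by zero: the open sets \<open>U\<close> and \<open>- S\<close> cover the
  space, and on their intersection the function vanishes together with its gradient, so the
  extension is \<open>C\<^sup>1\<close> everywhere.\<close>

lemma has_integral_partial_compact_support:
  fixes \<phi> :: "real^'n::finite \<Rightarrow> real"
  assumes U: "open U" "compact S" "S \<subseteq> U" and \<phi>: "C1_on U \<phi>" and supp: "\<And>x. x \<in> U - S \<Longrightarrow> \<phi> x = 0"
  shows "((\<lambda>x. if x \<in> S then grad \<phi> x $ i else 0) has_integral 0) UNIV"
proof -
  define \<psi> where "\<psi> x = (if x \<in> U then \<phi> x else 0)" for x
  define \<psi>' where "\<psi>' x = (if x \<in> U then grad \<phi> x else 0)" for x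
  have op: "open (- S)" using U(2) by (simp add: compact_imp_closed open_Compl)
  have z: "grad \<phi> x = 0" if "x \<in> U - S" for x
  proof (rule grad_unique)
    show "(\<phi> has_derivative (\<bullet>) 0) (at x)"
    proof (rule has_derivative_transform_within_open)
      show "((\<lambda>x. 0) has_derivative (\<bullet>) 0) (at x)" by (auto intro!: derivative_eq_intros)
      show "open (U - S)" using U op by (simp add: Diff_eq open_Int)
    qed (use that supp in auto)
  qed
  have D: "(\<psi> has_derivative inner (\<psi>' x)) (at x)" for x
  proof (cases "x \<in> U")
    case True
    show ?thesis
      by (rule has_derivative_transform_within_open[OF C1_on_grad(1)[OF \<phi> True] U(1) True, THEN has_derivative_eq_rhs])
         (use True in \<open>auto simp: \<psi>_def \<psi>'_def\<close>)
  next
    case False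
    show ?thesis
    proof (rule has_derivative_transform_within_open[OF _ op])
      show "((\<lambda>x. 0) has_derivative (\<bullet>) (\<psi>' x)) (at x)"
        using False by (auto intro!: derivative_eq_intros simp: \<psi>'_def)
    qed (use False U supp in \<open>auto simp: \<psi>_def\<close>)
  qed
  have "continuous_on (U \<union> - S) \<psi>'"
  proof (rule continuous_on_open_Un[OF U(1) op])
    show "continuous_on U \<psi>'"
      using C1_on_grad(2)[OF \<phi>] by (rule continuous_on_eq) (simp add: \<psi>'_def)
    show "continuous_on (- S) \<psi>'"
      using continuous_on_const[of "-S" 0] by (rule continuous_on_eq) (use z in \<open>auto simp: \<psi>'_def\<close>)
  qed
  then have c: "continuous_on UNIV \<psi>'"
  proof -
    have "U \<union> - S = UNIV" using U(3) by blast
    with \<open>continuous_on (U \<union> - S) \<psi>'\<close> show ?thesis by simp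
  qed
  have "((\<lambda>x. \<psi>' x \<bullet> axis i 1) has_integral 0) UNIV"
    by (rule has_integral_directional_derivative_global[OF D c compact_imp_bounded[OF U(2)]])
       (use z supp in \<open>auto simp: \<psi>_def \<psi>'_def\<close>)
  moreover have "\<psi>' x \<bullet> axis i 1 = (if x \<in> S then grad \<phi> x $ i else 0)" for x
    using z U by (auto simp: \<psi>'_def inner_axis)
  ultimately show ?thesis by simp
qed

text \<open>The exponent starts at 2 because the positive part itself has a corner at 0. This is why
  the weights below are the square and the cube of \<open>bump\<close>.\<close>

lemma DERIV_pos_part_power:
  "((\<lambda>t::real. (max 0 t) ^ Suc (Suc k)) has_real_derivative real (Suc (Suc k)) * (max 0 t) ^ Suc k) (at t)"
proof -
  consider "t > 0" | "t < 0" | "t = 0" by linarith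
  then show ?thesis
  proof cases
    case 1
    have "((\<lambda>t. t ^ Suc (Suc k)) has_real_derivative real (Suc (Suc k)) * t ^ Suc k) (at t)"
      using DERIV_pow[of "Suc (Suc k)" t] by simp
    then show ?thesis
      by (rule has_field_derivative_transform_within_open[of _ _ _ "{0<..}", THEN DERIV_cong]) (use 1 in auto)
  next
    case 2
    have "((\<lambda>t. 0) has_real_derivative 0) (at t)" by simp
    then show ?thesis
      by (rule has_field_derivative_transform_within_open[of _ _ _ "{..<0}", THEN DERIV_cong]) (use 2 in auto)
  next
    case 3
    have "((\<lambda>y. (max 0 y) ^ Suc (Suc k) / y) \<longlongrightarrow> 0) (at (0::real))"
    proof (rule Lim_null_comparison)
      show "\<forall>\<^sub>F y in at (0::real). norm (max 0 y ^ Suc (Suc k) / y) \<le> \<bar>y\<bar> ^ Suc k"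
        by (rule always_eventually) (auto simp: max_def mult_nonpos_nonneg)
      show "((\<lambda>y. \<bar>y\<bar> ^ Suc k) \<longlongrightarrow> 0) (at (0::real))"
        by (rule tendsto_eq_intros tendsto_rabs_zero | simp)+
    qed
    then show ?thesis using 3 by (simp add: has_field_derivative_iff)
  qed
qed

section \<open>The weighted flux identity\<close>

text \<open>For positive definite \<open>G\<close>, a paraboloid cap over the unit ball of the norm
  given by \<open>G\<close>. Its powers are weights of prescribed smoothness with explicit
  gradients.\<close>

definition bump :: "real^'n^'n \<Rightarrow> real^'n::finite \<Rightarrow> real" where
  "bump G y = max 0 (1 - y \<bullet> (G *v y))"

lemma bump_nonneg: "0 \<le> bump G y"
  by (simp add: bump_def)

lemma bump_eq_0_iff: "bump G y = 0 \<longleftrightarrow> 1 \<le> y \<bullet> (G *v y)"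
  by (auto simp: bump_def max_def)

lemma has_derivative_quadratic_form:
  fixes G :: "real^'n^'n::finite"
  assumes "transpose G = G"
  shows "((\<lambda>y. y \<bullet> (G *v y)) has_derivative inner (2 *\<^sub>R (G *v y))) (at y)"
proof -
  have "((\<lambda>v. G *v v) has_derivative (\<lambda>v. G *v v)) (at y)"
    by (intro bounded_linear_imp_has_derivative matrix_vector_mul_bounded_linear)
  then have "((\<lambda>y. y \<bullet> (G *v y)) has_derivative (\<lambda>v. y \<bullet> (G *v v) + v \<bullet> (G *v y))) (at y)"
    by (intro has_derivative_inner has_derivative_ident)
  moreover have "y \<bullet> (G *v v) = (G *v y) \<bullet> v" for v
    using dot_lmul_matrix[of y G v] assms by (metis vector_transpose_matrix)
  ultimately show ?thesis
    by (elim has_derivative_eq_rhs) (simp add: fun_eq_iff inner_commute)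
qed

text \<open>The gradient of a power is a multiple of the next lower power times
  \<open>G *v y\<close>. The factor 1/6 in the weight \<open>bump\<^sup>3 / 6\<close> is chosen to
  make that multiple of \<open>bump\<^sup>2\<close> equal to -1.\<close>

lemma C1_on_bump_power:
  assumes "transpose G = G"
  shows "C1_on S (\<lambda>y. bump G y ^ Suc (Suc k))"
    and "grad (\<lambda>y. bump G y ^ Suc (Suc k)) y = (- 2 * real (Suc (Suc k)) * bump G y ^ Suc k) *\<^sub>R (G *v y)"
proof -
  let ?f' = "\<lambda>y. (- 2 * real (Suc (Suc k)) * bump G y ^ Suc k) *\<^sub>R (G *v y)"
  have D: "((\<lambda>y. bump G y ^ Suc (Suc k)) has_derivative inner (?f' y)) (at y)" for y
  proof -
    have "((\<lambda>y. 1 - y \<bullet> (G *v y)) has_derivative (\<lambda>v. - inner (2 *\<^sub>R (G *v y)) v)) (at y)"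
      using has_derivative_diff[OF has_derivative_const has_derivative_quadratic_form[OF assms], of 1 y] by simp
    from has_derivative_compose[OF this DERIV_pos_part_power[of k, unfolded has_field_derivative_def]]
    show ?thesis unfolding bump_def by (rule has_derivative_eq_rhs) (auto simp: fun_eq_iff algebra_simps)
  qed
  have "continuous_on S (\<lambda>y. bump G y)"
    unfolding bump_def by (intro continuous_intros)
  then have "continuous_on S ?f'"
    by (intro continuous_intros)
  then show "C1_on S (\<lambda>y. bump G y ^ Suc (Suc k))" by (rule C1_onI[OF D])
  show "grad (\<lambda>y. bump G y ^ Suc (Suc k)) y = ?f' y"
    using D by (rule grad_unique)
qed

lemma grad_mult:
  assumes "(f has_derivative inner (grad f x)) (at x)" "(g has_derivative inner (grad g x)) (at x)"
  shows "grad (\<lambda>x. f x * g x) x = f x *\<^sub>R grad g x + g x *\<^sub>R grad f x"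
  by (rule grad_unique, rule has_derivative_eq_rhs[OF has_derivative_mult[OF assms]])
     (auto simp: inner_left_distrib)

lemma grad_add:
  assumes "(f has_derivative inner (grad f x)) (at x)" "(g has_derivative inner (grad g x)) (at x)"
  shows "grad (\<lambda>x. f x + g x) x = grad f x + grad g x"
  by (rule grad_unique, rule has_derivative_eq_rhs[OF has_derivative_add[OF assms]])
     (auto simp: inner_left_distrib)

text \<open>The integral of the divergence of \<open>\<eta> F + W k Q\<close>, with \<open>\<eta> = bump\<^sup>3 / 6\<close> and \<open>k = bump\<^sup>2\<close>.
  The term \<open>Q\<close>, which measures how far \<open>a\<close> is from its frozen value \<open>a0\<close>, is chosen such that
  \<open>\<nabla>\<eta> = - k G y\<close> turns the flux terms into the radial derivative of \<open>W\<close>.\<close>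

lemma weighted_flux_identity:
  fixes a :: "real^'n \<Rightarrow> real^'n^'n::finite" and G a0 :: "real^'n^'n" and W :: "real^'n \<Rightarrow> real"
  defines "S \<equiv> {y. y \<bullet> (G *v y) \<le> 1}"
    and "Q \<equiv> \<lambda>i y. \<Sum>j\<in>UNIV. (a y $ i $ j - a0 $ i $ j) * (G *v y) $ j"
    and "F \<equiv> \<lambda>i y. (a y *v grad W y) $ i"
  assumes U: "open U" "compact S" "S \<subseteq> U"
    and G: "transpose G = G" and a: "\<And>y. y \<in> U \<Longrightarrow> transpose (a y) = a y"
    and a0G: "\<And>y. a0 *v (G *v y) = b0 *\<^sub>R y"
    and C1: "C1_on U W" "\<And>i j. C1_on U (\<lambda>y. a y $ i $ j)" "\<And>i. C1_on U (F i)"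
  shows "((\<lambda>y. if y \<in> S then bump G y ^ 3 / 6 * (\<Sum>i\<in>UNIV. grad (F i) y $ i)
      - b0 * bump G y ^ 2 * (grad W y \<bullet> y)
      + W y * (\<Sum>i\<in>UNIV. - 4 * bump G y * (G *v y) $ i * Q i y + bump G y ^ 2 * grad (Q i) y $ i) else 0)
    has_integral 0) UNIV"
proof -
  define \<eta> where "\<eta> y = (1/6) * bump G y ^ 3" for y
  define k where "k y = bump G y ^ 2" for y
  define X where "X i y = \<eta> y * F i y + W y * (k y * Q i y)" for i y
  have C1k: "C1_on U k" and gk: "grad k y = (- 4 * bump G y) *\<^sub>R (G *v y)" for y
    using C1_on_bump_power[OF G, where k=0] unfolding k_def[abs_def] by (auto simp: numeral_2_eq_2)
  have C13: "C1_on U (\<lambda>y. bump G y ^ 3)" and g3: "grad (\<lambda>y. bump G y ^ 3) y = (- 6 * bump G y ^ 2) *\<^sub>R (G *v y)" for y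
    using C1_on_bump_power[OF G, where k=1] by (auto simp: numeral_3_eq_3 numeral_2_eq_2)
  have C1\<eta>: "C1_on U \<eta>"
    unfolding \<eta>_def[abs_def] by (intro C1_on_mult C1_on_const C13)
  have g\<eta>: "grad \<eta> y = - (k y *\<^sub>R (G *v y))" for y
  proof (rule grad_unique)
    have "((\<lambda>y. bump G y ^ 3) has_derivative inner ((- 6 * bump G y ^ 2) *\<^sub>R (G *v y))) (at y)"
      using C1_on_bump_power(1)[OF G, where k=1 and S=UNIV, THEN C1_on_grad(1)] g3 by (simp add: numeral_3_eq_3)
    from has_derivative_mult_right[OF this, of "1/6"]
    show "(\<eta> has_derivative inner (- (k y *\<^sub>R (G *v y)))) (at y)"
      unfolding \<eta>_def[abs_def] k_def by (rule has_derivative_eq_rhs) (auto simp: fun_eq_iff)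
  qed
  have C1Q: "C1_on U (Q i)" for i
    unfolding Q_def matrix_vector_mult_def
    by (auto intro!: C1_on_sum C1_on_mult C1_on_diff C1_on_const C1 C1_on_component)
  have C1X: "C1_on U (X i)" for i
    unfolding X_def[abs_def] by (intro C1_on_add C1_on_mult C1 C1k C1\<eta> C1Q)
  have "((\<lambda>y. if y \<in> S then grad (X i) y $ i else 0) has_integral 0) UNIV" for i
  proof (rule has_integral_partial_compact_support[OF U C1X])
    show "X i y = 0" if "y \<in> U - S" for y
      using that by (simp add: X_def \<eta>_def k_def S_def bump_def)
  qed
  then have "((\<lambda>y. \<Sum>i\<in>UNIV. if y \<in> S then grad (X i) y $ i else 0) has_integral (\<Sum>i\<in>(UNIV::'n set). 0)) UNIV"
    by (intro has_integral_sum) auto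
  moreover have "(\<Sum>i\<in>UNIV. if y \<in> S then grad (X i) y $ i else 0) =
    (if y \<in> S then bump G y ^ 3 / 6 * (\<Sum>i\<in>UNIV. grad (F i) y $ i)
      - b0 * bump G y ^ 2 * (grad W y \<bullet> y)
      + W y * (\<Sum>i\<in>UNIV. - 4 * bump G y * (G *v y) $ i * Q i y + bump G y ^ 2 * grad (Q i) y $ i) else 0)" for y
  proof (cases "y \<in> S")
    case True
    then have yU: "y \<in> U" using U by auto
    have gX: "grad (X i) y = \<eta> y *\<^sub>R grad (F i) y + F i y *\<^sub>R grad \<eta> y
        + (W y *\<^sub>R (k y *\<^sub>R grad (Q i) y + Q i y *\<^sub>R grad k y) + (k y * Q i y) *\<^sub>R grad W y)" for i
    proof -
      note D = C1_on_grad(1)[OF _ yU]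
      have "grad (X i) y = grad (\<lambda>y. \<eta> y * F i y) y + grad (\<lambda>y. W y * (k y * Q i y)) y"
        unfolding X_def[abs_def] by (intro grad_add D C1_on_mult C1 C1k C1\<eta> C1Q)
      also have "grad (\<lambda>y. \<eta> y * F i y) y = \<eta> y *\<^sub>R grad (F i) y + F i y *\<^sub>R grad \<eta> y"
        by (intro grad_mult D C1 C1\<eta>)
      also have "grad (\<lambda>y. W y * (k y * Q i y)) y = W y *\<^sub>R grad (\<lambda>y. k y * Q i y) y + (k y * Q i y) *\<^sub>R grad W y"
        by (intro grad_mult D C1_on_mult C1 C1k C1Q)
      also have "grad (\<lambda>y. k y * Q i y) y = k y *\<^sub>R grad (Q i) y + Q i y *\<^sub>R grad k y"
        by (intro grad_mult D C1k C1Q)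
      finally show ?thesis .
    qed
    have sym: "(\<Sum>i\<in>UNIV. v $ i * (A *v z) $ i) = (\<Sum>i\<in>UNIV. (A *v v) $ i * z $ i)"
      if "transpose A = A" for A :: "real^'n^'n" and v z
      using dot_lmul_matrix[of v A z] that unfolding inner_vec_def
      by (metis (no_types, lifting) inner_real_def sum.cong vector_transpose_matrix)
    have Q: "Q i y = (a y *v (G *v y)) $ i - b0 * y $ i" for i
      using arg_cong[OF a0G, of "\<lambda>v. v $ i" y]
      by (simp add: Q_def left_diff_distrib sum_subtractf matrix_vector_mult_def[of "a y"] matrix_vector_mult_def[of a0])
    \<comment> \<open>By \<open>a0G\<close>, \<open>Q\<close> is \<open>a y *v (G *v y)\<close>
      minus \<open>b0 *\<^sub>R y\<close>. Symmetry of \<open>a y\<close> moves it onto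
      \<open>grad W y\<close>, so the first part cancels the flux term that comes from
      \<open>grad \<eta>\<close>, and only the radial derivative survives.\<close>
    have "(\<Sum>i\<in>UNIV. Q i y * grad W y $ i) = (\<Sum>i\<in>UNIV. F i y * (G *v y) $ i) - b0 * (grad W y \<bullet> y)"
      unfolding F_def sym[OF a[OF yU], symmetric]
      by (simp add: Q inner_vec_def sum_subtractf sum_distrib_left algebra_simps)
    then have eq: "k y * (\<Sum>i\<in>UNIV. Q i y * grad W y $ i) =
        k y * (\<Sum>i\<in>UNIV. F i y * (G *v y) $ i) - b0 * k y * (grad W y \<bullet> y)"
      by (simp add: right_diff_distrib)
    have "(\<Sum>i\<in>UNIV. grad (X i) y $ i) = \<eta> y * (\<Sum>i\<in>UNIV. grad (F i) y $ i)
        - k y * (\<Sum>i\<in>UNIV. F i y * (G *v y) $ i) + k y * (\<Sum>i\<in>UNIV. Q i y * grad W y $ i)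
        + W y * (\<Sum>i\<in>UNIV. - 4 * bump G y * (G *v y) $ i * Q i y + k y * grad (Q i) y $ i)"
      unfolding sum_distrib_left sum_subtractf[symmetric] sum.distrib[symmetric]
      by (intro sum.cong refl) (simp add: gX gk g\<eta> algebra_simps)
    then show ?thesis using True eq
      by (simp add: \<eta>_def k_def)
  qed simp
  ultimately show ?thesis by simp
qed

section \<open>Growth of weighted averages\<close>

lemma C1_on_affine:
  assumes "C1_on B f"
  shows "C1_on {y. x0 + s *\<^sub>R y \<in> B} (\<lambda>y. f (x0 + s *\<^sub>R y))"
    and "x0 + s *\<^sub>R y \<in> B \<Longrightarrow> grad (\<lambda>y. f (x0 + s *\<^sub>R y)) y = s *\<^sub>R grad f (x0 + s *\<^sub>R y)"
proof -
  have D: "((\<lambda>y. f (x0 + s *\<^sub>R y)) has_derivative inner (s *\<^sub>R grad f (x0 + s *\<^sub>R y))) (at y)"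
    if "x0 + s *\<^sub>R y \<in> B" for y
  proof -
    have "((\<lambda>y. x0 + s *\<^sub>R y) has_derivative (\<lambda>v. s *\<^sub>R v)) (at y)"
      by (auto intro!: derivative_eq_intros)
    from has_derivative_compose[OF this C1_on_grad(1)[OF assms that]]
    show ?thesis by (rule has_derivative_eq_rhs) (auto simp: fun_eq_iff)
  qed
  show "C1_on {y. x0 + s *\<^sub>R y \<in> B} (\<lambda>y. f (x0 + s *\<^sub>R y))"
  proof (rule C1_onI)
    show "continuous_on {y. x0 + s *\<^sub>R y \<in> B} (\<lambda>y. s *\<^sub>R grad f (x0 + s *\<^sub>R y))"
      by (intro continuous_on_scaleR continuous_on_const continuous_on_compose2[OF C1_on_grad(2)[OF assms]])
         (auto intro!: continuous_intros)
  qed (use D in simp)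
  show "x0 + s *\<^sub>R y \<in> B \<Longrightarrow> grad (\<lambda>y. f (x0 + s *\<^sub>R y)) y = s *\<^sub>R grad f (x0 + s *\<^sub>R y)"
    using D by (rule grad_unique)
qed

lemma grad_cong_open:
  assumes "open S" "x \<in> S" "(f has_derivative inner (grad f x)) (at x)" "\<And>x. x \<in> S \<Longrightarrow> f x = g x"
  shows "grad g x = grad f x"
  by (rule grad_unique[OF has_derivative_transform_within_open[OF assms(3,1,2,4)]])

lemma abs_matrix_vector_component_le:
  fixes A :: "real^'n^'m::finite"
  assumes "\<And>j. \<bar>A $ i $ j\<bar> \<le> L" "norm v \<le> \<rho>" "0 \<le> L"
  shows "\<bar>(A *v v) $ i\<bar> \<le> real CARD('n::finite) * (L * \<rho>)"
proof -
  have "\<bar>(A *v v) $ i\<bar> \<le> (\<Sum>j\<in>UNIV. \<bar>A $ i $ j * v $ j\<bar>)"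
    unfolding matrix_vector_mult_def by simp
  also have "\<dots> \<le> (\<Sum>j\<in>(UNIV::'n set). L * \<rho>)"
    unfolding abs_mult using assms
    by (intro sum_mono mult_mono) (auto intro: order_trans[OF component_le_norm_cart])
  finally show ?thesis by simp
qed

lemma cube_norm_le:
  fixes y :: "real^'n::finite"
  assumes "y \<in> cbox (\<chi> i. -\<rho>) (\<chi> i. \<rho>)"
  shows "norm y \<le> real CARD('n) * \<rho>"
proof -
  have "norm y \<le> (\<Sum>i\<in>UNIV. \<bar>y $ i\<bar>)" by (rule norm_le_l1_cart)
  also have "\<dots> \<le> (\<Sum>i\<in>(UNIV::'n set). \<rho>)"
    using assms by (intro sum_mono) (simp add: mem_box_cart abs_le_iff minus_le_iff)
  finally show ?thesis by simp
qed

text \<open>The derivative in \<open>s\<close> of the weighted integral at scale \<open>s\<close> is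
  the integral of the radial derivative of \<open>w\<close>. By
  \<open>weighted_flux_identity\<close> for the rescaled function, \<open>b0 * s\<close> times this
  derivative is bounded below by a divergence term of order \<open>\<kappa> * s\<^sup>2\<close> and
  a coefficient error of order \<open>m * s\<close>; the error has the factor \<open>s\<close>
  because \<open>a - a x0\<close> is Lipschitz. Division by \<open>b0 * s\<close> and the mean value
  theorem on \<open>{0..R}\<close> give the claim.

  Here \<rho> bounds the semiaxes of the ellipsoid, \<open>L\<close> bounds the entries of
  \<open>G\<close> and the oscillation of \<open>a\<close>, \<open>(2 * \<rho>) ^ CARD('n)\<close>
  is the volume of a cube around the ellipsoid, and \<open>C L \<rho>\<close> adds over the
  coordinates the bounds for the term with \<open>Q\<close> and the term with its
  derivative.\<close>

lemma weighted_average_growth: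
  fixes a :: "real^'n \<Rightarrow> real^'n^'n::finite" and G :: "real^'n^'n" and w :: "real^'n \<Rightarrow> real"
  defines "F \<equiv> \<lambda>i x. (a x *v grad w x) $ i"
    and "N \<equiv> real CARD('n)"
  defines "C \<equiv> \<lambda>L \<rho>. N * (4 * (N * (L * \<rho>)) * (N * (L * (N * (L * \<rho>))) * \<rho>) + 2 * N^2 * L^2 * \<rho>)"
  assumes pos: "0 < R" "0 < \<rho>" "0 < b0" "0 \<le> L" "0 \<le> \<kappa>" "0 \<le> m" and rad: "R * (N * \<rho>) < r"
    and G: "transpose G = G" "\<And>z. (norm z)^2 \<le> \<rho>^2 * (z \<bullet> (G *v z))" "\<And>i j. \<bar>G $ i $ j\<bar> \<le> L"
    and a: "\<And>x. x \<in> ball x0 r \<Longrightarrow> transpose (a x) = a x"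
      "\<And>x i j. x \<in> ball x0 r \<Longrightarrow> \<bar>a x $ i $ j - a x0 $ i $ j\<bar> \<le> L * norm (x - x0)"
      "\<And>x i j. x \<in> ball x0 r \<Longrightarrow> norm (grad (\<lambda>x. a x $ i $ j) x) \<le> L"
    and a0G: "\<And>z. a x0 *v (G *v z) = b0 *\<^sub>R z"
    and C1: "C1_on (ball x0 r) w" "\<And>i j. C1_on (ball x0 r) (\<lambda>x. a x $ i $ j)" "\<And>i. C1_on (ball x0 r) (F i)"
    and div: "\<And>x. x \<in> ball x0 r \<Longrightarrow> (\<Sum>i\<in>UNIV. grad (F i) x $ i) \<ge> - \<kappa>"
    and w: "\<And>x. x \<in> ball x0 r \<Longrightarrow> 0 \<le> w x" "\<And>x. x \<in> ball x0 r \<Longrightarrow> w x \<le> m"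
  shows "integral (cbox (\<chi> i. -\<rho>) (\<chi> i. \<rho>)) (\<lambda>y. w (x0 + R *\<^sub>R y) * bump G y ^ 2) \<ge>
    w x0 * integral (cbox (\<chi> i. -\<rho>) (\<chi> i. \<rho>)) (\<lambda>y. bump G y ^ 2)
      - R * (\<kappa> * R + C L \<rho> * m) * (2 * \<rho>) ^ CARD('n) / b0"
proof -
  define K :: "(real^'n) set" where "K = cbox (\<chi> i. -\<rho>) (\<chi> i. \<rho>)"
  define S where "S = {y. y \<bullet> (G *v y) \<le> 1}"
  define A where "A s = integral K (\<lambda>y. w (x0 + s *\<^sub>R y) * bump G y ^ 2)" for s
  define A' where "A' s = integral K (\<lambda>y. (grad w (x0 + s *\<^sub>R y) \<bullet> y) * bump G y ^ 2)" for s
  let ?V = "(2 * \<rho>) ^ CARD('n)"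
  have N: "N \<ge> 1" unfolding N_def using zero_less_card_finite[where 'a='n] by linarith
  have q0: "0 \<le> z \<bullet> (G *v z)" for z
  proof -
    have "0 \<le> \<rho>^2 * (z \<bullet> (G *v z))" by (rule order_trans[OF _ G(2)]) simp
    then show ?thesis using pos by (simp add: zero_le_mult_iff)
  qed
  have bump1: "bump G y \<le> 1" for y using q0[of y] by (simp add: bump_def)
  have Sn: "norm y \<le> \<rho>" if "y \<in> S" for y
  proof -
    have "(norm y)^2 \<le> \<rho>^2 * 1"
      using that by (intro order_trans[OF G(2)] mult_left_mono) (auto simp: S_def)
    then show ?thesis using pos by (simp add: power2_le_iff_abs_le)
  qed
  have KS: "S \<subseteq> K"
  proof
    fix y assume "y \<in> S"
    then have "\<bar>y $ i\<bar> \<le> \<rho>" for i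
      using Sn component_le_norm_cart order_trans by blast
    then show "y \<in> K"
      by (simp add: K_def mem_box_cart abs_le_iff minus_le_iff)
  qed
  have contbump: "continuous_on X (bump G)" for X
    unfolding bump_def[abs_def] by (intro continuous_intros)
  have compS: "compact S"
  proof -
    have "closed S" unfolding S_def by (intro closed_Collect_le continuous_intros)
    then show ?thesis using KS K_def bounded_cbox bounded_subset compact_eq_bounded_closed by metis
  qed
  have inball: "x0 + s *\<^sub>R y \<in> ball x0 r" if "y \<in> K" "s \<in> {0..R}" for s y
  proof -
    have "norm (s *\<^sub>R y) \<le> R * (N * \<rho>)"
      unfolding norm_scaleR N_def using that cube_norm_le[of y \<rho>] by (intro mult_mono) (auto simp: K_def)
    then show ?thesis using rad by (simp add: dist_norm)
  qed
  have contgw: "continuous_on ({0..R} \<times> K) (\<lambda>(s, y). (grad w (x0 + s *\<^sub>R y) \<bullet> y) * bump G y ^ 2)"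
    unfolding split_def
    by (intro continuous_intros continuous_on_compose2[OF C1_on_grad(2)[OF C1(1)]] continuous_on_compose2[OF contbump[of UNIV]])
       (use inball in auto)
  have contw: "continuous_on K (\<lambda>y. w (x0 + s *\<^sub>R y) * bump G y ^ 2)" if "s \<in> {0..R}" for s
    by (intro continuous_intros continuous_on_compose2[OF C1_on_continuous[OF C1(1)]] contbump)
       (use inball[OF _ that] in auto)
  have dA: "(A has_field_derivative A' s) (at s within {0..R})" if "s \<in> {0..R}" for s
    unfolding A_def[abs_def] A'_def K_def
  proof (rule leibniz_rule_field_derivative)
    fix s y assume s: "s \<in> {0..R}" and y: "y \<in> cbox (\<chi> i. -\<rho>) (\<chi> i::'n. \<rho>)"
    have "((\<lambda>s. x0 + s *\<^sub>R y) has_derivative (\<lambda>h. h *\<^sub>R y)) (at s within {0..R})"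
      by (auto intro!: derivative_eq_intros)
    then have "((\<lambda>s. w (x0 + s *\<^sub>R y)) has_derivative (\<lambda>h. grad w (x0 + s *\<^sub>R y) \<bullet> (h *\<^sub>R y))) (at s within {0..R})"
      by (rule has_derivative_compose[OF _ C1_on_grad(1)[OF C1(1)]]) (use inball s y K_def in auto)
    then have "((\<lambda>s. w (x0 + s *\<^sub>R y)) has_field_derivative (grad w (x0 + s *\<^sub>R y) \<bullet> y)) (at s within {0..R})"
      by (rule has_derivative_imp_has_field_derivative) simp
    then show "((\<lambda>s. w (x0 + s *\<^sub>R y) * bump G y ^ 2) has_field_derivative (grad w (x0 + s *\<^sub>R y) \<bullet> y) * bump G y ^ 2) (at s within {0..R})"
      by (rule DERIV_cmult_right)
  qed (use contw contgw that in \<open>auto simp: K_def intro!: integrable_continuous\<close>)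
  \<comment> \<open>Only positive \<open>s\<close>, since the rescaled identity controls
    \<open>s * A' s\<close>. The mean value theorem below asks for interior points only.\<close>
  have lower: "A' s \<ge> - (\<kappa> * R + C L \<rho> * m) * ?V / b0" if s: "s \<in> {0<..R}" for s
  proof -
    define U where "U = {y. x0 + s *\<^sub>R y \<in> ball x0 r}"
    have oU: "open U" unfolding U_def
      by (simp only: mem_ball) (intro open_Collect_less continuous_intros)
    have KU: "K \<subseteq> U" using inball s by (auto simp: U_def)
    define W where "W y = w (x0 + s *\<^sub>R y)" for y
    define as where "as y = a (x0 + s *\<^sub>R y)" for y
    define Q where "Q i y = (\<Sum>j\<in>UNIV. (as y $ i $ j - a x0 $ i $ j) * (G *v y) $ j)" for i y
    define Fs where "Fs i y = (as y *v grad W y) $ i" for i y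
    have C1W: "C1_on U W" and gW: "y \<in> U \<Longrightarrow> grad W y = s *\<^sub>R grad w (x0 + s *\<^sub>R y)" for y
      unfolding U_def W_def[abs_def] using C1_on_affine[OF C1(1)] by auto
    have C1as: "C1_on U (\<lambda>y. as y $ i $ j)"
      and gas: "y \<in> U \<Longrightarrow> grad (\<lambda>y. as y $ i $ j) y = s *\<^sub>R grad (\<lambda>x. a x $ i $ j) (x0 + s *\<^sub>R y)" for i j y
      unfolding U_def as_def using C1_on_affine[OF C1(2)[of i j]] by auto
    have Fs: "s * F i (x0 + s *\<^sub>R y) = Fs i y" if "y \<in> U" for i y
      by (simp add: Fs_def F_def as_def gW[OF that] matrix_vector_mult_scaleR)
    have C1sF: "C1_on U (\<lambda>y. s * F i (x0 + s *\<^sub>R y))" for i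
      unfolding U_def by (intro C1_on_mult C1_on_const C1_on_affine C1)
    have C1Fs: "C1_on U (Fs i)" for i
      by (rule C1_on_cong[OF oU C1sF Fs])
    \<comment> \<open>One factor \<open>s\<close> comes from \<open>grad W\<close>, the other from
      the chain rule.\<close>
    have gFs: "grad (Fs i) y = s^2 *\<^sub>R grad (F i) (x0 + s *\<^sub>R y)" if "y \<in> U" for i y
    proof -
      have "grad (Fs i) y = grad (\<lambda>y. s * F i (x0 + s *\<^sub>R y)) y"
        by (rule grad_cong_open[OF oU that C1_on_grad(1)[OF C1sF that] Fs])
      also have "\<dots> = s *\<^sub>R grad (\<lambda>y. F i (x0 + s *\<^sub>R y)) y + F i (x0 + s *\<^sub>R y) *\<^sub>R grad (\<lambda>y. s) y"
        using that unfolding U_def by (intro grad_mult C1_on_grad(1)[OF C1_on_affine(1)[OF C1(3)]]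
          C1_on_grad(1)[OF C1_on_const[of U]]) (auto simp: U_def)
      also have "grad (\<lambda>y. s) y = 0" by (rule grad_unique) (auto intro!: derivative_eq_intros)
      finally show ?thesis
        using C1_on_affine(2)[OF C1(3)] that by (simp add: U_def power2_eq_square)
    qed
    \<comment> \<open>Both are of order \<open>s\<close>: the difference of the coefficients by the
      Lipschitz bound, the derivative of \<open>as\<close> by scaling.\<close>
    have gQ: "\<bar>grad (Q i) y $ i\<bar> \<le> s * (2 * N^2 * L^2 * \<rho>)"
      and Qb: "\<bar>Q i y\<bar> \<le> s * (N * (L * (N * (L * \<rho>))) * \<rho>)" if "y \<in> S" for i y
    proof -
      have y: "y \<in> U" "norm y \<le> \<rho>" using that KS KU Sn by auto
      have x: "x0 + s *\<^sub>R y \<in> ball x0 r" using y by (simp add: U_def)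
      have Gy: "\<bar>(G *v y) $ j\<bar> \<le> N * (L * \<rho>)" for j
        unfolding N_def by (rule abs_matrix_vector_component_le[OF G(3) y(2) pos(4)])
      have da: "\<bar>as y $ i $ j - a x0 $ i $ j\<bar> \<le> s * (L * \<rho>)" for i j
      proof -
        have "\<bar>as y $ i $ j - a x0 $ i $ j\<bar> \<le> L * norm (s *\<^sub>R y)"
          using a(2)[OF x, of i j] by (simp add: as_def)
        also have "\<dots> = s * (L * norm y)" using s by simp
        also have "\<dots> \<le> s * (L * \<rho>)" using s pos y by (intro mult_left_mono) auto
        finally show ?thesis .
      qed
      have "\<bar>Q i y\<bar> \<le> (\<Sum>j\<in>UNIV. \<bar>(as y $ i $ j - a x0 $ i $ j) * (G *v y) $ j\<bar>)"
        unfolding Q_def by (rule sum_abs)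
      also have "\<dots> \<le> (\<Sum>j\<in>(UNIV::'n set). (s * (L * \<rho>)) * (N * (L * \<rho>)))"
        unfolding abs_mult using da Gy s pos N by (intro sum_mono mult_mono) auto
      also have "\<dots> = s * (N * (L * (N * (L * \<rho>))) * \<rho>)" by (simp add: N_def algebra_simps)
      finally show "\<bar>Q i y\<bar> \<le> s * (N * (L * (N * (L * \<rho>))) * \<rho>)" .
      define q where "q = (\<Sum>j\<in>UNIV. (as y $ i $ j - a x0 $ i $ j) *\<^sub>R (G $ j) + (G *v y) $ j *\<^sub>R (s *\<^sub>R grad (\<lambda>x. a x $ i $ j) (x0 + s *\<^sub>R y)))"
      have "grad (Q i) y = q"
      proof (rule grad_unique)
        have Gd: "((\<lambda>y. (G *v y) $ j) has_derivative inner (G $ j)) (at y)" for j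
        proof -
          have "(\<lambda>y. (G *v y) $ j) = inner (G $ j)"
            by (auto simp: matrix_vector_mul_component)
          then show ?thesis by (simp add: bounded_linear_imp_has_derivative bounded_linear_inner_right)
        qed
        have ad: "((\<lambda>y. as y $ i $ j - a x0 $ i $ j) has_derivative inner (s *\<^sub>R grad (\<lambda>x. a x $ i $ j) (x0 + s *\<^sub>R y))) (at y)" for j
          using has_derivative_diff[OF C1_on_grad(1)[OF C1as y(1)] has_derivative_const, of i j "a x0 $ i $ j"] gas[OF y(1), of i j]
          by (elim has_derivative_eq_rhs) (simp add: fun_eq_iff)
        show "(Q i has_derivative inner q) (at y)"
          unfolding Q_def[abs_def]
          by (rule has_derivative_eq_rhs, rule has_derivative_sum, rule has_derivative_mult[OF ad Gd])
             (auto simp: fun_eq_iff q_def inner_sum_left inner_left_distrib mult.commute intro!: sum.cong)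
      qed
      then have "\<bar>grad (Q i) y $ i\<bar> = \<bar>\<Sum>j\<in>UNIV. (as y $ i $ j - a x0 $ i $ j) * G $ j $ i + (G *v y) $ j * (s * grad (\<lambda>x. a x $ i $ j) (x0 + s *\<^sub>R y) $ i)\<bar>"
        by (simp add: q_def mult.assoc)
      also have "\<dots> \<le> (\<Sum>j\<in>UNIV. \<bar>as y $ i $ j - a x0 $ i $ j\<bar> * \<bar>G $ j $ i\<bar> + \<bar>(G *v y) $ j\<bar> * (s * \<bar>grad (\<lambda>x. a x $ i $ j) (x0 + s *\<^sub>R y) $ i\<bar>))"
        using s by (intro order_trans[OF sum_abs] sum_mono order_trans[OF abs_triangle_ineq]) (simp add: abs_mult)
      also have "\<dots> \<le> (\<Sum>j\<in>(UNIV::'n set). (s * (L * \<rho>)) * L + (N * (L * \<rho>)) * (s * L))"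
        using da Gy G(3) s pos N order_trans[OF component_le_norm_cart a(3)[OF x]]
        by (intro sum_mono add_mono mult_mono) auto
      also have "\<dots> = s * (L^2 * \<rho> * N * (1 + N))" by (simp add: N_def algebra_simps power2_eq_square)
      also have "\<dots> \<le> s * (L^2 * \<rho> * N * (2 * N))"
        using s pos N by (intro mult_left_mono) auto
      also have "\<dots> = s * (2 * N^2 * L^2 * \<rho>)" by (simp add: power2_eq_square)
      finally show "\<bar>grad (Q i) y $ i\<bar> \<le> s * (2 * N^2 * L^2 * \<rho>)" .
    qed
    define P where "P y = bump G y ^ 3 / 6 * (\<Sum>i\<in>UNIV. grad (Fs i) y $ i)
      - b0 * bump G y ^ 2 * (grad W y \<bullet> y)
      + W y * (\<Sum>i\<in>UNIV. - 4 * bump G y * (G *v y) $ i * Q i y + bump G y ^ 2 * grad (Q i) y $ i)" for y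
    have "((\<lambda>y. if y \<in> S then P y else 0) has_integral 0) UNIV"
      unfolding P_def S_def Fs_def[abs_def] Q_def[abs_def]
      by (rule weighted_flux_identity[OF oU _ _ G(1) _ a0G C1W C1as])
         (use compS KS KU a(1) C1Fs in \<open>auto simp: S_def U_def as_def Fs_def[abs_def] dist_norm\<close>)
    then have "((\<lambda>y. if y \<in> K then (if y \<in> S then P y else 0) else 0) has_integral 0) UNIV"
      by (rule has_integral_eq[rotated]) (use KS in auto)
    then have I0: "((\<lambda>y. if y \<in> S then P y else 0) has_integral 0) K"
      by (simp only: has_integral_restrict_UNIV)
    have "continuous_on K (\<lambda>y. (grad w (x0 + s *\<^sub>R y) \<bullet> y) * bump G y ^ 2)"
    proof -
      have "continuous_on K (Pair s)" "Pair s ` K \<subseteq> {0..R} \<times> K"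
        using s by (auto intro!: continuous_intros)
      from continuous_on_compose2[OF contgw this] show ?thesis by simp
    qed
    then have "((\<lambda>y. (grad w (x0 + s *\<^sub>R y) \<bullet> y) * bump G y ^ 2) has_integral A' s) K"
      unfolding A'_def K_def by (intro integrable_integral integrable_continuous)
    moreover have "((\<lambda>y. - (\<kappa> * s^2 + s * (C L \<rho> * m))) has_integral ?V *\<^sub>R - (\<kappa> * s^2 + s * (C L \<rho> * m))) K"
    proof -
      have "measure lborel K = ?V"
        unfolding K_def using pos by (subst content_cbox_cart) (auto simp: interval_eq_empty_cart)
      then show ?thesis
        using has_integral_const[of "- (\<kappa> * s^2 + s * (C L \<rho> * m))" "\<chi> i::'n. -\<rho>" "\<chi> i. \<rho>"]
        by (simp add: K_def)
    qed
    ultimately have I1: "((\<lambda>y. - (\<kappa> * s^2 + s * (C L \<rho> * m)) - b0 * s * ((grad w (x0 + s *\<^sub>R y) \<bullet> y) * bump G y ^ 2))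
        has_integral (?V *\<^sub>R - (\<kappa> * s^2 + s * (C L \<rho> * m)) - b0 * s * A' s)) K"
      by (intro has_integral_diff has_integral_mult_right)
    have C0: "0 \<le> C L \<rho>" unfolding C_def using pos N by simp
    \<comment> \<open>The integrands are compared pointwise: replacing the divergence term and the
      coefficient error in \<open>P\<close> by their worst values can only lower it, and
      \<open>P\<close> integrates to 0. Outside the ellipsoid the weight vanishes and the constants
      have the right sign.\<close>
    have "?V *\<^sub>R - (\<kappa> * s^2 + s * (C L \<rho> * m)) - b0 * s * A' s \<le> 0"
    proof (rule has_integral_le[OF I1 I0])
      fix y assume yK: "y \<in> K"
      show "- (\<kappa> * s^2 + s * (C L \<rho> * m)) - b0 * s * ((grad w (x0 + s *\<^sub>R y) \<bullet> y) * bump G y ^ 2)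
        \<le> (if y \<in> S then P y else 0)"
      proof (cases "y \<in> S")
        case False
        then have "bump G y = 0" by (simp add: bump_eq_0_iff S_def)
        moreover have "0 \<le> \<kappa> * s^2 + s * (C L \<rho> * m)" using pos s C0 by simp
        ultimately show ?thesis using False by simp
      next
        case True
        have yU: "y \<in> U" and x: "x0 + s *\<^sub>R y \<in> ball x0 r" using yK KU by (auto simp: U_def)
        let ?D = "\<Sum>i\<in>UNIV. grad (F i) (x0 + s *\<^sub>R y) $ i"
        let ?E = "\<Sum>i\<in>UNIV. - 4 * bump G y * (G *v y) $ i * Q i y + bump G y ^ 2 * grad (Q i) y $ i"
        have b: "0 \<le> bump G y" "bump G y \<le> 1" by (simp_all add: bump_nonneg bump1)
        have b2: "bump G y ^ k \<le> 1" for k using b by (rule power_le_one)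
        have "- \<kappa> * s^2 \<le> bump G y ^ 3 / 6 * (s^2 * ?D)"
        proof -
          have "- (s^2 * ?D) \<le> s^2 * \<kappa>" using div[OF x] mult_left_mono[of "-?D" \<kappa> "s^2"] by simp
          then have "bump G y ^ 3 / 6 * (- (s^2 * ?D)) \<le> bump G y ^ 3 / 6 * (s^2 * \<kappa>)"
            using b by (intro mult_left_mono) auto
          also have "\<dots> \<le> 1 * (s^2 * \<kappa>)"
            using b2[of 3] pos by (intro mult_right_mono) auto
          finally show ?thesis by (simp add: mult.commute)
        qed
        moreover have "- (s * (C L \<rho> * m)) \<le> W y * ?E"
        proof -
          have "\<bar>?E\<bar> \<le> (\<Sum>i\<in>UNIV. \<bar>- 4 * bump G y * (G *v y) $ i * Q i y + bump G y ^ 2 * grad (Q i) y $ i\<bar>)"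
            by (rule sum_abs)
          also have "\<dots> \<le> (\<Sum>i\<in>(UNIV::'n set). 4 * (N * (L * \<rho>)) * (s * (N * (L * (N * (L * \<rho>))) * \<rho>)) + s * (2 * N^2 * L^2 * \<rho>))"
          proof (rule sum_mono)
            fix i
            have Gy: "\<bar>(G *v y) $ i\<bar> \<le> N * (L * \<rho>)"
              unfolding N_def by (rule abs_matrix_vector_component_le[OF G(3) Sn[OF True] pos(4)])
            have "\<bar>- 4 * bump G y * (G *v y) $ i * Q i y + bump G y ^ 2 * grad (Q i) y $ i\<bar>
              \<le> \<bar>4 * bump G y * (G *v y) $ i * Q i y\<bar> + \<bar>bump G y ^ 2 * grad (Q i) y $ i\<bar>"
              by linarith
            also have "\<bar>4 * bump G y * (G *v y) $ i * Q i y\<bar> = bump G y * (4 * \<bar>(G *v y) $ i\<bar> * \<bar>Q i y\<bar>)"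
              using b by (simp add: abs_mult)
            also have "\<dots> \<le> 1 * (4 * (N * (L * \<rho>)) * (s * (N * (L * (N * (L * \<rho>))) * \<rho>)))"
              using b pos N Gy Qb[OF True, of i] by (intro mult_mono) auto
            also have "\<bar>bump G y ^ 2 * grad (Q i) y $ i\<bar> = bump G y ^ 2 * \<bar>grad (Q i) y $ i\<bar>"
              by (simp add: abs_mult)
            also have "\<dots> \<le> 1 * (s * (2 * N^2 * L^2 * \<rho>))"
              using b b2[of 2] gQ[OF True, of i] by (intro mult_mono) auto
            finally show "\<bar>- 4 * bump G y * (G *v y) $ i * Q i y + bump G y ^ 2 * grad (Q i) y $ i\<bar> \<le>
              4 * (N * (L * \<rho>)) * (s * (N * (L * (N * (L * \<rho>))) * \<rho>)) + s * (2 * N^2 * L^2 * \<rho>)" by simp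
          qed
          also have "\<dots> = s * C L \<rho>" by (simp add: C_def N_def[symmetric] algebra_simps)
          finally have E: "\<bar>?E\<bar> \<le> s * C L \<rho>" .
          have "\<bar>W y * ?E\<bar> \<le> m * (s * C L \<rho>)"
            unfolding abs_mult using E w[OF x] pos by (intro mult_mono) (auto simp: W_def)
          then show ?thesis by (simp add: abs_le_iff mult_ac)
        qed
        moreover have "P y = bump G y ^ 3 / 6 * (s^2 * ?D) - b0 * s * ((grad w (x0 + s *\<^sub>R y) \<bullet> y) * bump G y ^ 2) + W y * ?E"
          by (simp add: P_def gFs[OF yU] gW[OF yU] sum_distrib_left)
        ultimately show ?thesis using True by simp
      qed
    qed
    then have "s * (- (\<kappa> * s + C L \<rho> * m) * ?V) \<le> s * (b0 * A' s)"
      by (simp add: algebra_simps power2_eq_square)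
    then have "- (\<kappa> * s + C L \<rho> * m) * ?V \<le> b0 * A' s"
      using s by (simp only: mult_le_cancel_left_pos greaterThanAtMost_iff)
    moreover have "- (\<kappa> * R + C L \<rho> * m) * ?V \<le> - (\<kappa> * s + C L \<rho> * m) * ?V"
      using s pos by (intro mult_right_mono) (auto intro: mult_left_mono)
    ultimately have "- (\<kappa> * R + C L \<rho> * m) * ?V \<le> A' s * b0"
      by (simp only: mult.commute[of b0])
    then show ?thesis
      using pos by (simp only: pos_divide_le_eq)
  qed
  have "\<exists>s\<in>{0<..<R}. A R - A 0 = (\<lambda>h. h * A' s) (R - 0)"
  proof (rule mvt_simple[OF pos(1)])
    show "(A has_derivative (\<lambda>h. h * A' s)) (at s within {0..R})" if "0 \<le> s" "s \<le> R" for s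
      using dA[of s] that by (simp add: has_field_derivative_def mult.commute[of _ "A' s"])
  qed
  then obtain s where s: "s \<in> {0<..<R}" "A R - A 0 = R * A' s" by auto
  have "R * (- (\<kappa> * R + C L \<rho> * m) * ?V / b0) \<le> R * A' s"
    using s lower[of s] pos by (intro mult_left_mono) auto
  moreover have "R * (- (\<kappa> * R + C L \<rho> * m) * ?V / b0) = - (R * (\<kappa> * R + C L \<rho> * m) * ?V / b0)"
    by (simp only: mult_minus_left mult_minus_right divide_minus_left times_divide_eq_right mult.assoc)
  ultimately have "A R \<ge> A 0 - R * (\<kappa> * R + C L \<rho> * m) * ?V / b0"
    using s(2) by linarith
  then show ?thesis by (simp add: A_def K_def)
qed

section \<open>Truncated powers and local bounds\<close>

text \<open>At a boundary point the cutoff is dominated by \<open>\<bar>f\<bar>\<close>, which tends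
  to 0 there; this comparison works for any shape of the boundary.\<close>

lemma continuous_on_cutoff:
  fixes f :: "'a::t2_space \<Rightarrow> real"
  assumes \<Omega>: "open \<Omega>" and f: "continuous_on \<Omega> f" and A: "open A"
    and bd: "\<And>x. x \<in> \<Omega> \<Longrightarrow> x \<in> closure A \<Longrightarrow> x \<notin> A \<Longrightarrow> f x = 0"
  shows "continuous_on \<Omega> (\<lambda>x. if x \<in> A then f x else 0)"
proof -
  have "continuous (at x) (\<lambda>x. if x \<in> A then f x else 0)" if x: "x \<in> \<Omega>" for x
  proof -
    have fx: "(f \<longlongrightarrow> f x) (at x)" using f \<Omega> x by (metis continuous_on_def at_within_open)
    consider "x \<in> A" | "x \<notin> closure A" | "f x = 0" "x \<notin> A" using bd x by blast
    then show ?thesis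
    proof cases
      case 1
      then have "\<forall>\<^sub>F y in at x. y \<in> A" using A by (simp add: eventually_at_in_open')
      then have "\<forall>\<^sub>F y in at x. (if y \<in> A then f y else 0) = f y" by eventually_elim simp
      then show ?thesis using fx 1 by (simp add: isCont_def tendsto_cong)
    next
      case 2
      then have "\<forall>\<^sub>F y in at x. y \<in> - closure A"
        by (intro eventually_at_in_open') auto
      then have "\<forall>\<^sub>F y in at x. (if y \<in> A then f y else 0) = 0"
        by eventually_elim (use closure_subset in auto)
      moreover have "x \<notin> A" using 2 closure_subset by auto
      ultimately show ?thesis by (simp add: isCont_def tendsto_cong)
    next
      case 3
      have "((\<lambda>y. if y \<in> A then f y else 0) \<longlongrightarrow> 0) (at x)"
        by (rule Lim_null_comparison[OF _ tendsto_rabs_zero]) (use fx 3 in \<open>auto intro: always_eventually\<close>)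
      then show ?thesis using 3 by (simp add: isCont_def)
    qed
  qed
  then show ?thesis by (simp add: continuous_at_imp_continuous_on)
qed

text \<open>The third power makes the truncation \<open>C\<^sup>1\<close> across the boundary of \<open>A\<close>, however irregular
  that boundary is.\<close>

lemma C1_on_cutoff_cube:
  assumes \<Omega>: "open \<Omega>" and f: "C1_on \<Omega> f" and A: "open A"
    and bd: "\<And>x. x \<in> \<Omega> \<Longrightarrow> x \<in> closure A \<Longrightarrow> x \<notin> A \<Longrightarrow> f x = 0"
  shows "C1_on \<Omega> (\<lambda>x. if x \<in> A then f x ^ 3 else 0)" (is ?C)
    and "x \<in> \<Omega> \<Longrightarrow> grad (\<lambda>x. if x \<in> A then f x ^ 3 else 0) x = (if x \<in> A then 3 * f x ^ 2 else 0) *\<^sub>R grad f x"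
proof -
  let ?p = "\<lambda>x. if x \<in> A then f x ^ 3 else 0"
  let ?p' = "\<lambda>x. (if x \<in> A then 3 * f x ^ 2 else 0) *\<^sub>R grad f x"
  have D: "(?p has_derivative inner (?p' x)) (at x)" if x: "x \<in> \<Omega>" for x
  proof -
    have f3: "((\<lambda>x. f x ^ 3) has_derivative inner ((3 * f x ^ 2) *\<^sub>R grad f x)) (at x)"
      by (rule has_derivative_eq_rhs[OF has_derivative_power[OF C1_on_grad(1)[OF f x], of 3]])
         (auto simp: fun_eq_iff)
    consider "x \<in> A" | "x \<notin> closure A" | "f x = 0" "x \<notin> A" using bd x by blast
    then show ?thesis
    proof cases
      case 1
      show ?thesis
        by (rule has_derivative_transform_within_open[OF _ A 1]) (use f3 1 in auto)
    next
      case 2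
      then have "x \<notin> A" using closure_subset by auto
      then have "((\<lambda>x. 0) has_derivative inner (?p' x)) (at x)" by (auto intro!: derivative_eq_intros)
      then show ?thesis
        by (rule has_derivative_transform_within_open[where s="- closure A"]) (use 2 closure_subset in auto)
    next
      case 3
      \<comment> \<open>Since \<open>f x = 0\<close>, the untruncated cube has derivative 0 at
        \<open>x\<close>, and its difference quotient dominates that of the truncation.\<close>
      have "((\<lambda>y. norm (f y ^ 3) / norm (y - x)) \<longlongrightarrow> 0) (at x)"
        using f3 3 by (simp add: has_derivative_iff_norm)
      then have "((\<lambda>y. norm (?p y) / norm (y - x)) \<longlongrightarrow> 0) (at x)"
        by (rule tendsto_sandwich[OF _ _ tendsto_const, rotated 2])
           (auto intro!: always_eventually)
      then show ?thesis using 3 by (simp add: has_derivative_iff_norm bounded_linear_inner_right)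
    qed
  qed
  have "continuous_on \<Omega> (\<lambda>x. if x \<in> A then 3 * f x ^ 2 else 0)"
    by (rule continuous_on_cutoff[OF \<Omega> _ A]) (use bd C1_on_continuous[OF f] in \<open>auto intro!: continuous_intros\<close>)
  then have "continuous_on \<Omega> ?p'"
    by (intro continuous_on_scaleR C1_on_grad(2)[OF f])
  then show ?C using D by (intro C1_onI[where f'="?p'"])
  show "grad ?p x = ?p' x" if "x \<in> \<Omega>"
    using D[OF that] by (rule grad_unique)
qed

lemma grad_lipschitz:
  assumes "convex S" "C1_on S f" "\<And>x. x \<in> S \<Longrightarrow> norm (grad f x) \<le> L" "x \<in> S" "y \<in> S"
  shows "\<bar>f x - f y\<bar> \<le> L * norm (x - y)"
proof -
  have "norm (f x - f y) \<le> L * norm (x - y)"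
  proof (rule differentiable_bound[OF assms(1) _ _ assms(4,5)])
    show "(f has_derivative inner (grad f z)) (at z within S)" if "z \<in> S" for z
      using C1_on_grad(1)[OF assms(2) that] by (rule has_derivative_at_withinI)
    show "onorm (inner (grad f z)) \<le> L" if "z \<in> S" for z
    proof (rule onorm_le)
      show "norm (grad f z \<bullet> v) \<le> L * norm v" for v
        using Cauchy_Schwarz_ineq2[of "grad f z" v] mult_right_mono[OF assms(3)[OF that], of "norm v"]
        by simp
    qed
  qed
  then show ?thesis by simp
qed

section \<open>Uniform constants for the metric on a compact set\<close>

lemma matrix_inv_mult_mat:
  fixes A :: "real^'n^'n::finite"
  assumes "det A \<noteq> 0"
  shows "matrix_inv A ** A = mat 1"
  using mat_mult_matrix_inv[OF assms] by (simp add: matrix_left_right_inverse)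

lemma transpose_matrix_inv:
  fixes A :: "real^'n^'n::finite"
  assumes "det A \<noteq> 0" "transpose A = A"
  shows "transpose (matrix_inv A) = matrix_inv A"
proof -
  have "transpose (matrix_inv A) ** A = mat 1"
    using arg_cong[OF mat_mult_matrix_inv[OF assms(1)], of transpose] assms(2)
    by (simp add: matrix_transpose_mul transpose_mat)
  then have "transpose (matrix_inv A) ** (A ** matrix_inv A) = matrix_inv A"
    by (simp add: matrix_mul_assoc)
  then show ?thesis by (simp add: mat_mult_matrix_inv[OF assms(1)])
qed

lemma bounded_on_compact:
  fixes f :: "'a::topological_space \<Rightarrow> real"
  assumes "compact K" "continuous_on K f"
  shows "\<exists>B\<ge>0. \<forall>x\<in>K. f x \<le> B"
proof -
  obtain B where "\<forall>x\<in>K. norm (f x) \<le> B"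
    using compact_imp_bounded[OF compact_continuous_image[OF assms(2,1)]] by (auto simp: bounded_iff)
  then have "\<forall>x\<in>K. f x \<le> max 0 B" by fastforce
  then show ?thesis by (intro exI[of _ "max 0 B"]) auto
qed

text \<open>Lets a single compactness argument, applied to the sum, bound all entries at
  once.\<close>

lemma matrix_entry_le_sum:
  fixes h :: "'i::finite \<Rightarrow> 'j::finite \<Rightarrow> real"
  assumes "\<And>i j. 0 \<le> h i j"
  shows "h i j \<le> (\<Sum>i\<in>UNIV. \<Sum>j\<in>UNIV. h i j)"
proof -
  have "h i j \<le> (\<Sum>j\<in>UNIV. h i j)" by (rule member_le_sum) (use assms in auto)
  also have "\<dots> \<le> (\<Sum>i\<in>UNIV. \<Sum>j\<in>UNIV. h i j)"
    by (rule member_le_sum[of i UNIV "\<lambda>i. \<Sum>j\<in>UNIV. h i j"]) (use assms in \<open>auto intro: sum_nonneg\<close>)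
  finally show ?thesis .
qed

text \<open>The quadratic form attains a positive minimum \<theta> on the compact set
  \<open>K \<times> sphere 0 1\<close>, and homogeneity extends the bound to all \<open>z\<close>.
  The constant is written as a square because \<open>\<rho> = 1 / sqrt \<theta>\<close> then bounds
  the semiaxes of all the ellipsoids over \<open>K\<close>.\<close>

lemma uniform_ellipticity:
  fixes G :: "real^'n \<Rightarrow> real^'n^'n::finite"
  assumes K: "compact K" and G: "continuous_on K G"
    and pos: "\<And>x v. x \<in> K \<Longrightarrow> v \<noteq> 0 \<Longrightarrow> v \<bullet> (G x *v v) > 0"
  shows "\<exists>\<rho>>0. \<forall>x\<in>K. \<forall>z. (norm z)^2 \<le> \<rho>^2 * (z \<bullet> (G x *v z))"
proof (cases "K = {}")
  case False
  let ?T = "K \<times> sphere (0::real^'n) 1"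
  let ?q = "\<lambda>(x, z). z \<bullet> (G x *v z)"
  have "compact ?T" using K by (intro compact_Times) auto
  moreover have "?T \<noteq> {}"
    using False norm_axis_1 by fastforce
  moreover have "continuous_on ?T ?q"
    unfolding split_def inner_vec_def matrix_vector_mult_def
    by (simp, intro continuous_intros continuous_on_compose2[OF G]) auto
  ultimately obtain t where t: "t \<in> ?T" "\<forall>s\<in>?T. ?q t \<le> ?q s"
    using continuous_attains_inf[of ?T ?q] by blast
  define \<theta> where "\<theta> = ?q t"
  have \<theta>: "\<theta> > 0" using t(1) by (auto simp: \<theta>_def intro!: pos)
  have "(norm z)^2 \<le> (1 / sqrt \<theta>)^2 * (z \<bullet> (G x *v z))" if "x \<in> K" for x z
  proof (cases "z = 0")
    case False
    define y where "y = (1 / norm z) *\<^sub>R z"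
    have z: "z = norm z *\<^sub>R y" and "norm y = 1" using False by (auto simp: y_def)
    then have "\<theta> \<le> y \<bullet> (G x *v y)" using t(2) that by (auto simp: \<theta>_def)
    then have "(norm z)^2 * \<theta> \<le> (norm z)^2 * (y \<bullet> (G x *v y))" by (intro mult_left_mono) auto
    also have "\<dots> = (norm z *\<^sub>R y) \<bullet> (G x *v (norm z *\<^sub>R y))"
      by (simp add: matrix_vector_mult_scaleR power2_eq_square)
    finally have "(norm z)^2 * \<theta> \<le> z \<bullet> (G x *v z)" using z by simp
    then show ?thesis using \<theta> by (simp add: power_divide field_simps)
  qed simp
  then show ?thesis using \<theta> by (intro exI[of _ "1 / sqrt \<theta>"]) auto
qed (auto intro: exI[of _ 1])

text \<open>On the cube of half-side \<delta> the quadratic form is at most 1/2, hence the weight at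
  least 1/4. The bound sees \<open>G\<close> only through \<open>L\<close>, so it is uniform in the
  centre of the ellipsoid.\<close>

lemma bump_integral_lower:
  fixes G :: "real^'n^'n::finite"
  assumes L: "1 \<le> L" "\<And>i j. \<bar>G $ i $ j\<bar> \<le> L" and \<delta>: "0 < \<delta>" "\<delta> \<le> \<rho>" "\<delta> \<le> 1 / (2 * real CARD('n)^2 * L)"
  shows "(2 * \<delta>) ^ CARD('n) / 4 \<le> integral (cbox (\<chi> i. -\<rho>) (\<chi> i. \<rho>)) (\<lambda>y. bump G y ^ 2)"
proof -
  let ?N = "real CARD('n)"
  have N: "?N \<ge> 1" using zero_less_card_finite[where 'a='n] by linarith
  have c: "continuous_on X (\<lambda>y. bump G y ^ 2)" for X
    unfolding bump_def[abs_def] by (intro continuous_intros)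
  let ?k = "cbox (\<chi> i. -\<delta>) (\<chi> i. \<delta>) :: (real^'n) set"
  let ?K = "cbox (\<chi> i. -\<rho>) (\<chi> i. \<rho>) :: (real^'n) set"
  have sub: "?k \<subseteq> ?K"
  proof
    fix y assume "y \<in> ?k"
    then have "- \<delta> \<le> y $ i" "y $ i \<le> \<delta>" for i by (auto simp: mem_box_cart)
    then show "y \<in> ?K"
      using \<delta>(2) by (auto simp: mem_box_cart intro: order_trans[of _ \<delta>] order_trans[of "- \<rho>" "- \<delta>"])
  qed
  have "measure lborel ?k = (2 * \<delta>) ^ CARD('n)"
    using \<delta> by (subst content_cbox_cart) (auto simp: interval_eq_empty_cart)
  then have "((\<lambda>y. 1/4) has_integral (2 * \<delta>) ^ CARD('n) / 4) ?k"
    using has_integral_const[of "1/4::real" "\<chi> i::'n. -\<delta>" "\<chi> i. \<delta>"] by simp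
  then have "(2 * \<delta>) ^ CARD('n) / 4 \<le> integral ?k (\<lambda>y. bump G y ^ 2)"
  proof (elim has_integral_le)
    show "((\<lambda>y. bump G y ^ 2) has_integral integral ?k (\<lambda>y. bump G y ^ 2)) ?k"
      by (intro integrable_integral integrable_continuous c)
    fix y :: "real^'n" assume y: "y \<in> ?k"
    have ny: "norm y \<le> ?N * \<delta>" by (rule cube_norm_le[OF y])
    have "y \<bullet> (G *v y) \<le> (\<Sum>i\<in>UNIV. \<bar>y $ i\<bar> * \<bar>(G *v y) $ i\<bar>)"
      unfolding inner_vec_def by (intro sum_mono) (simp add: abs_mult[symmetric])
    also have "\<dots> \<le> (\<Sum>i\<in>(UNIV::'n set). \<delta> * (?N * (L * (?N * \<delta>))))"
      using y L \<delta> by (intro sum_mono mult_mono abs_matrix_vector_component_le ny)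
        (auto simp: mem_box_cart abs_le_iff minus_le_iff)
    also have "\<dots> = ?N * ?N^2 * L * \<delta> * \<delta>" by (simp add: power2_eq_square)
    also have "\<dots> \<le> 1/2"
    proof -
      \<comment> \<open>The quantity to bound is the product of \<open>?N^2 * L * \<delta>\<close>
        and \<open>?N * \<delta>\<close>; the choice of \<delta> makes the first factor at most 1/2
        and the second at most 1.\<close>
      have 1: "2 * (?N^2 * L * \<delta>) \<le> 1"
        using \<delta>(3) L(1) N by (simp add: field_simps)
      have "?N * \<delta> * 1 \<le> ?N * \<delta> * (2 * (?N * L))"
        using \<delta>(1) L(1) N mult_mono[of 1 ?N 1 L] by (intro mult_left_mono) auto
      also have "\<dots> = 2 * (?N^2 * L * \<delta>)" by (simp add: power2_eq_square)
      finally have "?N * \<delta> \<le> 1" using 1 by simp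
      moreover have "?N^2 * L * \<delta> \<le> 1/2" using 1 by simp
      ultimately have "(?N^2 * L * \<delta>) * (?N * \<delta>) \<le> 1/2 * 1"
        using \<delta>(1) L(1) N by (intro mult_mono) auto
      then show ?thesis by (simp add: algebra_simps)
    qed
    finally have "1/2 \<le> bump G y" by (simp add: bump_def)
    then show "1/4 \<le> bump G y ^ 2" using power_mono[of "1/2" "bump G y" 2] by (simp add: power2_eq_square)
  qed
  also have "\<dots> \<le> integral ?K (\<lambda>y. bump G y ^ 2)"
    by (intro integral_subset_le sub integrable_continuous c) simp
  finally show ?thesis .
qed

section \<open>The maximum estimate in a coordinate ball\<close>

text \<open>With \<open>p\<close> the truncated cube, \<open>w\<close> is \<open>f * p\<close> and
  has gradient \<open>4 * p\<close> times that of \<open>f\<close>, so its flux is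
  \<open>4 * p\<close> times the flux \<Phi> of \<open>f\<close>. In the divergence, the equation
  turns the term with \<open>p\<close> into \<open>- 4 * \<mu> * b * w\<close>; the term with
  \<open>grad p\<close> is on \<open>A\<close> a nonnegative multiple of the energy density of
  \<open>f\<close>.\<close>

lemma fourth_power_subsolution:
  fixes G :: "real^'n \<Rightarrow> real^'n^'n::finite" and f :: "real^'n \<Rightarrow> real" and A :: "(real^'n) set"
  defines "b \<equiv> \<lambda>x. sqrt (det (G x))"
  defines "\<Phi> \<equiv> \<lambda>i x. b x * (matrix_inv (G x) *v grad f x) $ i"
    and "w \<equiv> \<lambda>x. if x \<in> A then f x ^ 4 else 0"
  defines "F \<equiv> \<lambda>i x. ((b x *\<^sub>R matrix_inv (G x)) *v grad w x) $ i"
  assumes \<Omega>: "open \<Omega>"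
    and G: "\<And>i j. C1_on \<Omega> (\<lambda>x. G x $ i $ j)"
      "\<And>x v. x \<in> \<Omega> \<Longrightarrow> v \<noteq> 0 \<Longrightarrow> v \<bullet> (G x *v v) > 0"
    and f: "C1_on \<Omega> f" "\<And>i. C1_on \<Omega> (partial i f)"
    and eq: "\<And>x. x \<in> \<Omega> \<Longrightarrow> (\<Sum>i\<in>UNIV. partial i (\<Phi> i) x) = - (\<mu> * b x * f x)"
    and A: "open A" "\<And>x. x \<in> \<Omega> \<Longrightarrow> x \<in> closure A \<Longrightarrow> x \<notin> A \<Longrightarrow> f x = 0"
  shows "C1_on \<Omega> w" and "C1_on \<Omega> (F i)"
    and "x \<in> \<Omega> \<Longrightarrow> - (4 * \<mu> * b x * w x) \<le> (\<Sum>i\<in>UNIV. grad (F i) x $ i)"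
proof -
  define p where "p x = (if x \<in> A then f x ^ 3 else 0)" for x
  have det: "det (G x) > 0" if "x \<in> \<Omega>" for x
    using G(2)[OF that] by (rule det_pos_definite)
  have p: "C1_on \<Omega> p" "x \<in> \<Omega> \<Longrightarrow> grad p x = (if x \<in> A then 3 * f x ^ 2 else 0) *\<^sub>R grad f x" for x
    unfolding p_def[abs_def] using C1_on_cutoff_cube[OF \<Omega> f(1) A] by auto
  have w: "w = (\<lambda>x. f x * p x)"
    by (auto simp: fun_eq_iff w_def p_def power_Suc[symmetric] simp del: power_Suc)
  show "C1_on \<Omega> w" unfolding w by (intro C1_on_mult f p)
  have gw: "grad w x = (4 * p x) *\<^sub>R grad f x" if "x \<in> \<Omega>" for x
    unfolding w using that grad_mult[OF C1_on_grad(1)[OF f(1) that] C1_on_grad(1)[OF p(1) that]] p(2)[OF that]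
    by (cases "x \<in> A") (auto simp: p_def vec_eq_iff power3_eq_cube power2_eq_square)
  have nz: "det (G x) \<noteq> 0" if "x \<in> \<Omega>" for x
    using det[OF that] by simp
  have C1b: "C1_on \<Omega> b"
    unfolding b_def by (intro C1_on_sqrt C1_on_det G(1) det)
  have C1\<Phi>: "C1_on \<Omega> (\<Phi> i)" for i
    unfolding \<Phi>_def matrix_vector_mult_def grad_def vec_lambda_beta
    by (intro C1_on_mult C1_on_sum C1b C1_on_matrix_inv[OF \<Omega> G(1) nz] f(2))
  have F: "4 * p x * \<Phi> i x = F i x" if "x \<in> \<Omega>" for i x
    by (simp add: F_def \<Phi>_def gw[OF that] matrix_vector_mult_scaleR scaleR_matrix_vector_assoc[symmetric])
  have C14: "C1_on \<Omega> (\<lambda>x. 4 * p x)" by (intro C1_on_mult C1_on_const p)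
  have C1F: "C1_on \<Omega> (\<lambda>x. 4 * p x * \<Phi> i x)" for i
    by (intro C1_on_mult[OF C14] C1\<Phi>)
  show "C1_on \<Omega> (F i)" by (rule C1_on_cong[OF \<Omega> C1F F])
  show "- (4 * \<mu> * b x * w x) \<le> (\<Sum>i\<in>UNIV. grad (F i) x $ i)" if x: "x \<in> \<Omega>"
  proof -
    have g4: "grad (\<lambda>x. 4 * p x) x = 4 *\<^sub>R grad p x"
      by (rule grad_unique, rule has_derivative_eq_rhs[OF has_derivative_mult_right[OF C1_on_grad(1)[OF p(1) x]]]) auto
    have "grad (F i) x = (4 * p x) *\<^sub>R grad (\<Phi> i) x + \<Phi> i x *\<^sub>R (4 *\<^sub>R grad p x)" for i
      using grad_cong_open[OF \<Omega> x C1_on_grad(1)[OF C1F x] F]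
        grad_mult[OF C1_on_grad(1)[OF C14 x] C1_on_grad(1)[OF C1\<Phi> x]] by (simp add: g4)
    then have "(\<Sum>i\<in>UNIV. grad (F i) x $ i) =
        4 * p x * (\<Sum>i\<in>UNIV. grad (\<Phi> i) x $ i) + 4 * (\<Sum>i\<in>UNIV. \<Phi> i x * grad p x $ i)"
      by (simp add: sum.distrib sum_distrib_left mult_ac)
    also have "(\<Sum>i\<in>UNIV. grad (\<Phi> i) x $ i) = - (\<mu> * b x * f x)"
      using eq[OF x] by (simp add: grad_def)
    also have "(\<Sum>i\<in>UNIV. \<Phi> i x * grad p x $ i) =
      (if x \<in> A then 3 * f x ^ 2 else 0) * b x * ((matrix_inv (G x) *v grad f x) \<bullet> grad f x)"
      by (simp add: p(2)[OF x] \<Phi>_def inner_vec_def sum_distrib_left mult_ac)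
    finally have "(\<Sum>i\<in>UNIV. grad (F i) x $ i) = - (4 * \<mu> * b x * w x) +
      4 * ((if x \<in> A then 3 * f x ^ 2 else 0) * b x * ((matrix_inv (G x) *v grad f x) \<bullet> grad f x))"
      by (simp add: w algebra_simps)
    moreover have "0 \<le> (matrix_inv (G x) *v grad f x) \<bullet> grad f x"
    proof -
      let ?z = "matrix_inv (G x) *v grad f x"
      have "grad f x = G x *v ?z"
        using det[OF x] by (simp add: matrix_vector_mul_assoc mat_mult_matrix_inv)
      moreover have "0 \<le> ?z \<bullet> (G x *v ?z)"
        using G(2)[OF x, of ?z] by (cases "?z = 0") auto
      ultimately show ?thesis by simp
    qed
    ultimately show ?thesis
      using det[OF x] by (simp add: b_def)
  qed
qed

lemma max_le_local_average:
  fixes G :: "real^'n \<Rightarrow> real^'n^'n::finite"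
  defines "b \<equiv> \<lambda>x. sqrt (det (G x))"
  assumes \<Omega>: "open \<Omega>" "0 < r" "cball xc (2 * r) \<subseteq> \<Omega>"
    and G: "\<And>i j. C1_on \<Omega> (\<lambda>x. G x $ i $ j)" "\<And>x. x \<in> \<Omega> \<Longrightarrow> transpose (G x) = G x"
      "\<And>x v. x \<in> \<Omega> \<Longrightarrow> v \<noteq> 0 \<Longrightarrow> v \<bullet> (G x *v v) > 0"
  shows "\<exists>C>0. \<exists>\<mu>0>0. \<forall>\<mu>\<ge>\<mu>0. \<forall>f A x0. C1_on \<Omega> f \<longrightarrow> (\<forall>i. C1_on \<Omega> (partial i f)) \<longrightarrow>
    (\<forall>x\<in>\<Omega>. (\<Sum>i\<in>UNIV. partial i (\<lambda>x. b x * (matrix_inv (G x) *v grad f x) $ i) x) = - (\<mu> * b x * f x)) \<longrightarrow>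
    open A \<longrightarrow> (\<forall>x\<in>\<Omega>. x \<in> closure A \<longrightarrow> x \<notin> A \<longrightarrow> f x = 0) \<longrightarrow>
    x0 \<in> A \<inter> cball xc r \<longrightarrow> (\<forall>x\<in>A \<inter> \<Omega>. \<bar>f x\<bar> \<le> \<bar>f x0\<bar>) \<longrightarrow>
    \<bar>f x0\<bar> \<le> C * \<mu> powr (real CARD('n) / 2) * (LINT x:A \<inter> cball xc (2 * r)|lborel. \<bar>f x\<bar>)"
proof -
  define K where "K = cball xc (2 * r)"
  have K: "compact K" "convex K" "K \<subseteq> \<Omega>" using \<Omega> by (auto simp: K_def)
  define a where "a x = b x *\<^sub>R matrix_inv (G x)" for x
  have det: "det (G x) > 0" if "x \<in> \<Omega>" for x
    using G(3)[OF that] by (rule det_pos_definite)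
  have C1b: "C1_on \<Omega> b" unfolding b_def by (intro C1_on_sqrt C1_on_det G(1) det)
  have C1a: "C1_on \<Omega> (\<lambda>x. a x $ i $ j)" for i j
  proof -
    have "det (G x) \<noteq> 0" if "x \<in> \<Omega>" for x using det[OF that] by simp
    then have "C1_on \<Omega> (\<lambda>x. b x * matrix_inv (G x) $ i $ j)"
      by (intro C1_on_mult C1b C1_on_matrix_inv[OF \<Omega>(1) G(1)])
    then show ?thesis by (simp add: a_def)
  qed
  have contG: "continuous_on K G"
  proof -
    have "continuous_on K (\<lambda>x. \<chi> i j. G x $ i $ j)"
      by (intro continuous_on_vec_lambda C1_on_continuous[OF C1_on_subset[OF G(1) K(3)]])
    then show ?thesis by simp
  qed
  obtain L1 where L1: "L1 \<ge> 0" "\<And>x i j. x \<in> K \<Longrightarrow> \<bar>G x $ i $ j\<bar> \<le> L1"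
  proof -
    have "continuous_on K (\<lambda>x. \<Sum>i\<in>UNIV. \<Sum>j\<in>UNIV. \<bar>G x $ i $ j\<bar>)"
      by (intro continuous_intros C1_on_continuous[OF C1_on_subset[OF G(1) K(3)]])
    from bounded_on_compact[OF K(1) this] obtain B where "B \<ge> 0" "\<forall>x\<in>K. (\<Sum>i\<in>UNIV. \<Sum>j\<in>UNIV. \<bar>G x $ i $ j\<bar>) \<le> B"
      by blast
    then show ?thesis
      using order_trans[OF matrix_entry_le_sum[of "\<lambda>i j. \<bar>G x $ i $ j\<bar>" for x], of _ B] by (intro that[of B]) auto
  qed
  obtain L2 where L2: "L2 \<ge> 0" "\<And>x i j. x \<in> K \<Longrightarrow> norm (grad (\<lambda>x. a x $ i $ j) x) \<le> L2"
  proof -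
    have "continuous_on K (\<lambda>x. \<Sum>i\<in>UNIV. \<Sum>j\<in>UNIV. norm (grad (\<lambda>x. a x $ i $ j) x))"
      by (intro continuous_intros C1_on_grad(2)[OF C1_on_subset[OF C1a K(3)]])
    from bounded_on_compact[OF K(1) this] obtain B where "B \<ge> 0" "\<forall>x\<in>K. (\<Sum>i\<in>UNIV. \<Sum>j\<in>UNIV. norm (grad (\<lambda>x. a x $ i $ j) x)) \<le> B"
      by blast
    then show ?thesis
      using order_trans[OF matrix_entry_le_sum[of "\<lambda>i j. norm (grad (\<lambda>x. a x $ i $ j) x)" for x], of _ B] by (intro that[of B]) auto
  qed
  obtain B where B: "B \<ge> 0" "\<And>x. x \<in> K \<Longrightarrow> b x \<le> B"
    using bounded_on_compact[OF K(1) C1_on_continuous[OF C1_on_subset[OF C1b K(3)]]] by blast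
  obtain \<beta> where \<beta>: "\<beta> > 0" "\<And>x. x \<in> K \<Longrightarrow> \<beta> \<le> b x"
  proof -
    have "K \<noteq> {}" using \<Omega>(2) by (simp add: K_def)
    then obtain z where "z \<in> K" "\<forall>x\<in>K. b z \<le> b x"
      using continuous_attains_inf[OF K(1) _ C1_on_continuous[OF C1_on_subset[OF C1b K(3)]]] by blast
    then show ?thesis using that[of "b z"] det[of z] K(3) by (auto simp: b_def)
  qed
  obtain \<rho> where \<rho>: "\<rho> > 0" "\<And>x z. x \<in> K \<Longrightarrow> (norm z)^2 \<le> \<rho>^2 * (z \<bullet> (G x *v z))"
    using uniform_ellipticity[OF K(1) contG] G(3) K(3) by (meson subsetD)
  define L where "L = L1 + L2 + 1"
  have L: "1 \<le> L" using L1 L2 by (simp add: L_def)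
  let ?N = "real CARD('n)"
  have N: "?N \<ge> 1" using zero_less_card_finite[where 'a='n] by linarith
  define \<delta> where "\<delta> = min \<rho> (1 / (2 * ?N^2 * L))"
  have \<delta>: "\<delta> > 0" using \<rho>(1) L N by (simp add: \<delta>_def)
  define c0 where "c0 = (2 * \<delta>) ^ CARD('n) / 4"
  have c0: "c0 > 0" using \<delta> by (simp add: c0_def)
  define V where "V = (2 * \<rho>) ^ CARD('n)"
  have V: "V > 0" using \<rho>(1) by (simp add: V_def)
  define CE where "CE = ?N * (4 * (?N * (L * \<rho>)) * (?N * (L * (?N * (L * \<rho>))) * \<rho>) + 2 * ?N^2 * L^2 * \<rho>)"
  have CE: "CE > 0" using L \<rho>(1) N unfolding CE_def by (intro mult_pos_pos add_pos_pos) auto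
  \<comment> \<open>Solves \<open>4 * (B + 1) * \<epsilon>\<^sup>2 * V = c0 * \<beta> / 4\<close>;
    with \<open>B + 1\<close> in place of \<open>B\<close> the denominator is visibly
    positive.\<close>
  define \<epsilon> where "\<epsilon> = sqrt (c0 * \<beta> / (16 * (B + 1) * V))"
  have \<epsilon>: "\<epsilon> > 0" using c0 \<beta>(1) B(1) V by (simp add: \<epsilon>_def)
  \<comment> \<open>The first bound keeps the scaled cube inside the ball of radius \<open>r\<close>
    about \<open>x0\<close>, the second makes \<open>R * CE * V\<close> at most
    \<open>c0 * \<beta> / 4\<close>.\<close>
  define R0 where "R0 = min (r / (2 * (?N * \<rho>))) (c0 * \<beta> / (4 * CE * V))"
  have R0: "R0 > 0" using c0 \<beta>(1) CE V \<Omega>(2) N \<rho>(1) by (simp add: R0_def)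
  have Cpos: "2 / (c0 * \<epsilon> ^ CARD('n)) > 0" and Mpos: "(\<epsilon> / R0)^2 > 0" using c0 \<epsilon> R0 by auto
  show ?thesis
  proof (rule exI, rule conjI[OF Cpos], rule exI, rule conjI[OF Mpos], intro allI impI)
    fix \<mu> f A x0
    assume \<mu>: "\<mu> \<ge> (\<epsilon> / R0)^2" and f: "C1_on \<Omega> f" "\<forall>i. C1_on \<Omega> (partial i f)"
      and eq: "\<forall>x\<in>\<Omega>. (\<Sum>i\<in>UNIV. partial i (\<lambda>x. b x * (matrix_inv (G x) *v grad f x) $ i) x) = - (\<mu> * b x * f x)"
      and A: "open A" "\<forall>x\<in>\<Omega>. x \<in> closure A \<longrightarrow> x \<notin> A \<longrightarrow> f x = 0"
      and x0: "x0 \<in> A \<inter> cball xc r" and mx: "\<forall>x\<in>A \<inter> \<Omega>. \<bar>f x\<bar> \<le> \<bar>f x0\<bar>"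
    have \<mu>0: "\<mu> > 0" using Mpos \<mu> by (rule less_le_trans)
    define R where "R = \<epsilon> / sqrt \<mu>"
    have R: "R > 0" using \<mu>0 \<epsilon> by (simp add: R_def)
    have RR0: "R \<le> R0"
    proof -
      have "\<epsilon> / R0 \<le> sqrt \<mu>" using \<mu> real_le_rsqrt by blast
      then show ?thesis using R0 \<mu>0 by (simp add: R_def field_simps)
    qed
    have R\<mu>: "R^2 * \<mu> = \<epsilon>^2" using \<mu>0 by (simp add: R_def power_divide)
    define w where "w x = (if x \<in> A then f x ^ 4 else 0)" for x
    define m where "m = f x0 ^ 4"
    have m: "m \<ge> 0" "w x0 = m" using x0 by (simp_all add: m_def w_def)
    have ballK: "ball x0 r \<subseteq> K"
    proof
      fix x assume "x \<in> ball x0 r"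
      then show "x \<in> K" using x0 dist_triangle[of xc x x0] by (simp add: K_def)
    qed
    then have ball\<Omega>: "ball x0 r \<subseteq> \<Omega>" using K by auto
    have x0K: "x0 \<in> K" using ballK \<Omega>(2) by auto
    have sub: "C1_on \<Omega> w" "C1_on \<Omega> (\<lambda>x. (a x *v grad w x) $ i)"
      "x \<in> \<Omega> \<Longrightarrow> - (4 * \<mu> * b x * w x) \<le> (\<Sum>i\<in>UNIV. grad (\<lambda>x. (a x *v grad w x) $ i) x $ i)" for i x
      using fourth_power_subsolution[OF \<Omega>(1) G(1,3) f(1) f(2)[rule_format] eq[unfolded b_def, rule_format] A(1) A(2)[rule_format]]
      unfolding a_def[abs_def] w_def[abs_def] b_def by auto
    \<comment> \<open>Since \<open>w\<close> vanishes off \<open>A\<close>, the maximum over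
      \<open>A\<close> bounds \<open>w\<close> on a full ball about \<open>x0\<close>, even where
      this ball leaves \<open>A\<close>.\<close>
    have wb: "0 \<le> w x" "w x \<le> m" if "x \<in> \<Omega>" for x
      using that mx power_mono[of "\<bar>f x\<bar>" "\<bar>f x0\<bar>" 4] by (auto simp: w_def m_def)
    have Rr: "R * (?N * \<rho>) < r"
    proof -
      have "R * (?N * \<rho>) \<le> (r / (2 * (?N * \<rho>))) * (?N * \<rho>)"
        using RR0 N \<rho>(1) by (intro mult_right_mono) (auto simp: R0_def)
      also have "\<dots> = r / 2" using N \<rho>(1) by simp
      finally show ?thesis using \<Omega>(2) by simp
    qed
    let ?box = "cbox (\<chi> i. -\<rho>) (\<chi> i. \<rho>) :: (real^'n) set"
    have "w x0 * integral ?box (\<lambda>y. bump (G x0) y ^ 2) - R * ((4 * \<mu> * B * m) * R + CE * m) * V / b x0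
        \<le> integral ?box (\<lambda>y. w (x0 + R *\<^sub>R y) * bump (G x0) y ^ 2)"
      unfolding CE_def V_def
    proof (rule weighted_average_growth[where a=a and r=r and L=L])
      show "0 < b x0" using \<beta> x0K by force
      show "transpose (G x0) = G x0" using G(2) x0K K by auto
      show "\<bar>G x0 $ i $ j\<bar> \<le> L" for i j using L1(2)[OF x0K, of i j] L2(1) by (simp add: L_def)
      show "(norm z)\<^sup>2 \<le> \<rho>\<^sup>2 * (z \<bullet> (G x0 *v z))" for z using \<rho>(2)[OF x0K] .
      show "a x0 *v (G x0 *v z) = b x0 *\<^sub>R z" for z
      proof -
        have "matrix_inv (G x0) *v (G x0 *v z) = z"
          using det[of x0] x0K K(3) by (subst matrix_vector_mul_assoc, subst matrix_inv_mult_mat) auto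
        then show ?thesis by (simp add: a_def scaleR_matrix_vector_assoc[symmetric])
      qed
      show "transpose (a x) = a x" if "x \<in> ball x0 r" for x
      proof -
        have "transpose (matrix_inv (G x)) = matrix_inv (G x)"
          using that ball\<Omega> det[of x] G(2)[of x] by (intro transpose_matrix_inv) auto
        then show ?thesis by (simp add: a_def vec_eq_iff transpose_def)
      qed
      show "norm (grad (\<lambda>x. a x $ i $ j) x) \<le> L" if "x \<in> ball x0 r" for x i j
        using L2(2)[of x i j] L1(1) that ballK by (auto simp: L_def)
      then show "\<bar>a x $ i $ j - a x0 $ i $ j\<bar> \<le> L * norm (x - x0)" if "x \<in> ball x0 r" for x i j
        using that \<Omega>(2) by (intro grad_lipschitz[OF convex_ball C1_on_subset[OF C1a ball\<Omega>]]) auto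
      show "C1_on (ball x0 r) (\<lambda>x. a x $ i $ j)" for i j by (rule C1_on_subset[OF C1a ball\<Omega>])
      show "C1_on (ball x0 r) w" by (rule C1_on_subset[OF sub(1) ball\<Omega>])
      show "C1_on (ball x0 r) (\<lambda>x. (a x *v grad w x) $ i)" for i by (rule C1_on_subset[OF sub(2) ball\<Omega>])
      show "- (4 * \<mu> * B * m) \<le> (\<Sum>i\<in>UNIV. grad (\<lambda>x. (a x *v grad w x) $ i) x $ i)" if "x \<in> ball x0 r" for x
      proof -
        have x: "x \<in> \<Omega>" "x \<in> K" using that ball\<Omega> ballK by auto
        have "4 * \<mu> * (b x * w x) \<le> 4 * \<mu> * (B * m)"
          using x B wb[OF x(1)] \<mu>0 by (intro mult_left_mono mult_mono) auto
        then show ?thesis using sub(3)[OF x(1)] by simp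
      qed
    qed (use Rr R \<rho>(1) L \<mu>0 B m wb ball\<Omega> in auto)
    moreover have "w x0 * c0 \<le> w x0 * integral ?box (\<lambda>y. bump (G x0) y ^ 2)"
      unfolding c0_def using m L \<delta> L1(2)[OF x0K] L2(1)
      by (intro mult_left_mono bump_integral_lower[where L=L]) (auto simp: \<delta>_def L_def add_increasing2)
    moreover have "R * ((4 * \<mu> * B * m) * R + CE * m) * V / b x0 \<le> m * (c0 / 2)"
    proof -
      have "R * ((4 * \<mu> * B * m) * R + CE * m) * V / b x0 \<le> R * ((4 * \<mu> * B * m) * R + CE * m) * V / \<beta>"
      proof (rule divide_left_mono)
        show "\<beta> \<le> b x0" by (rule \<beta>(2)[OF x0K])
        then show "0 < b x0 * \<beta>" using \<beta>(1) by simp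
        show "0 \<le> R * ((4 * \<mu> * B * m) * R + CE * m) * V" using R \<mu>0 B(1) m CE V by simp
      qed
      also have "\<dots> = m * ((4 * B * (R^2 * \<mu>) * V + R * (CE * V)) / \<beta>)"
        by (simp add: field_simps power2_eq_square)
      also have "\<dots> \<le> m * (c0 / 2)"
      proof (intro mult_left_mono m)
        have "4 * B * (R^2 * \<mu>) * V \<le> 4 * (B + 1) * \<epsilon>^2 * V"
          unfolding R\<mu> using B V by (intro mult_right_mono) auto
        also have "\<epsilon>^2 = c0 * \<beta> / (16 * (B + 1) * V)" using c0 \<beta>(1) B(1) V by (simp add: \<epsilon>_def)
        also have "4 * (B + 1) * (c0 * \<beta> / (16 * (B + 1) * V)) * V = c0 * \<beta> / 4"
        proof -
          have "4 * q * (t / (16 * q * V)) * V = t / 4" if "q \<noteq> 0" for q t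
            using that V by (simp add: field_simps)
          from this[of "B + 1" "c0 * \<beta>"] show ?thesis using B(1) by linarith
        qed
        finally have 1: "4 * B * (R^2 * \<mu>) * V \<le> c0 * \<beta> / 4" .
        have "R * (CE * V) \<le> c0 * \<beta> / (4 * CE * V) * (CE * V)"
          using RR0 CE V by (intro mult_right_mono) (auto simp: R0_def)
        also have "\<dots> = c0 * \<beta> / 4" using CE V by simp
        finally show "(4 * B * (R^2 * \<mu>) * V + R * (CE * V)) / \<beta> \<le> c0 / 2"
          using 1 \<beta>(1) by (simp add: divide_le_eq)
      qed
      finally show ?thesis .
    qed
    ultimately have low: "m * (c0 / 2) \<le> integral ?box (\<lambda>y. w (x0 + R *\<^sub>R y) * bump (G x0) y ^ 2)"
      unfolding m(2) by linarith
    let ?I = "LINT x:A \<inter> K|lborel. \<bar>f x\<bar>"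
    \<comment> \<open>Undoing the scaling costs \<open>R ^ CARD('n)\<close>, the source of the power
      of \<mu>. Three of the four factors of \<open>\<bar>f\<bar>\<close> are bounded by the
      maximum, the fourth stays under the integral.\<close>
    have "integral ?box (\<lambda>y. w (x0 + R *\<^sub>R y) * bump (G x0) y ^ 2) \<le> \<bar>f x0\<bar>^3 * ?I / R ^ CARD('n)"
    proof -
      let ?box' = "cbox (x0 + R *\<^sub>R (\<chi> i. -\<rho>)) (x0 + R *\<^sub>R (\<chi> i. \<rho>))"
      have contw: "continuous_on X w" if "X \<subseteq> \<Omega>" for X
        using C1_on_continuous[OF C1_on_subset[OF sub(1) that]] .
      have box'K: "?box' \<subseteq> K"
      proof
        fix x assume x: "x \<in> ?box'"
        have "norm (x - x0) \<le> real CARD('n) * (R * \<rho>)"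
          by (rule cube_norm_le) (use x in \<open>auto simp: mem_box_cart algebra_simps\<close>)
        also have "\<dots> < r" using Rr by (simp add: mult_ac)
        finally show "x \<in> K" using ballK by (auto simp: dist_norm norm_minus_commute)
      qed
      have int': "(w has_integral integral ?box' w) ?box'"
        by (intro integrable_integral integrable_continuous contw) (use box'K K in auto)
      have "((\<lambda>y. w (R *\<^sub>R y + x0)) has_integral integral ?box' w /\<^sub>R R ^ DIM(real^'n)) ?box"
        using has_integral_affinity'[OF int' R, of x0] R by simp
      then have aff: "((\<lambda>y. w (x0 + R *\<^sub>R y)) has_integral integral ?box' w / R ^ CARD('n)) ?box"
        by (simp add: add.commute divide_inverse mult.commute)
      have inK: "x0 + R *\<^sub>R y \<in> K" if "y \<in> ?box" for y
      proof (rule subsetD[OF box'K])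
        have "- \<rho> \<le> y $ i" "y $ i \<le> \<rho>" for i
          using that by (auto simp: mem_box_cart)
        then have "R * - \<rho> \<le> R * y $ i" "R * y $ i \<le> R * \<rho>" for i
          using R by (intro mult_left_mono; simp)+
        then show "x0 + R *\<^sub>R y \<in> ?box'" by (simp add: mem_box_cart)
      qed
      have "integral ?box (\<lambda>y. w (x0 + R *\<^sub>R y) * bump (G x0) y ^ 2) \<le> integral ?box (\<lambda>y. w (x0 + R *\<^sub>R y))"
      proof (rule integral_le)
        show "(\<lambda>y. w (x0 + R *\<^sub>R y) * bump (G x0) y ^ 2) integrable_on ?box"
          unfolding bump_def
          by (intro integrable_continuous continuous_intros continuous_on_compose2[OF contw[OF K(3)]]) (use inK in auto)
        show "(\<lambda>y. w (x0 + R *\<^sub>R y)) integrable_on ?box" using aff by blast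
        show "w (x0 + R *\<^sub>R y) * bump (G x0) y ^ 2 \<le> w (x0 + R *\<^sub>R y)" if "y \<in> ?box" for y
        proof (rule mult_left_le)
          have "0 \<le> y \<bullet> (G x0 *v y)" using G(3)[of x0 y] x0K K(3) by (cases "y = 0") auto
          then show "bump (G x0) y ^ 2 \<le> 1"
            by (intro power_le_one bump_nonneg) (simp add: bump_def)
          show "0 \<le> w (x0 + R *\<^sub>R y)" using wb inK[OF that] K(3) by auto
        qed
      qed
      also have "\<dots> = integral ?box' w / R ^ CARD('n)" using aff by (rule integral_unique)
      also have "integral ?box' w \<le> integral K w"
      proof (rule integral_subset_le[OF box'K])
        show "w integrable_on ?box'" using int' by blast
        show "w integrable_on K"
          using set_borel_integral_eq_integral(1)[of K w] borel_integrable_compact[OF K(1) contw[OF K(3)]]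
          by (simp add: set_integrable_def)
      qed (use wb K in auto)
      also have "integral K w = (LINT x:K|lborel. w x)"
        using set_borel_integral_eq_integral(2)[of K w] borel_integrable_compact[OF K(1) contw[OF K(3)]]
        by (simp add: set_integrable_def)
      also have "\<dots> \<le> \<bar>f x0\<bar>^3 * ?I"
      proof -
        \<comment> \<open>The cutoff of \<open>\<bar>f\<bar>\<close> is continuous on \<Omega>, so
          integrability over \<open>A \<inter> K\<close> reduces to integrability of a continuous
          function over the compact set \<open>K\<close>.\<close>
        let ?v = "\<lambda>x. if x \<in> A then \<bar>f x\<bar> else 0"
        have "continuous_on \<Omega> ?v"
          by (rule continuous_on_cutoff[OF \<Omega>(1) _ A(1)])
             (use A(2) C1_on_continuous[OF f(1)] in \<open>auto intro!: continuous_intros\<close>)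
        then have i: "integrable lborel (\<lambda>x. indicator K x *\<^sub>R ?v x)"
          by (intro borel_integrable_compact K(1)) (rule continuous_on_subset[OF _ K(3)])
        have eqv: "indicator K x *\<^sub>R ?v x = indicator (A \<inter> K) x *\<^sub>R \<bar>f x\<bar>" for x
          by (auto simp: indicator_def)
        have "(LINT x:K|lborel. w x) \<le> (\<integral>x. \<bar>f x0\<bar>^3 * (indicator K x *\<^sub>R ?v x) \<partial>lborel)"
          unfolding set_lebesgue_integral_def
        proof (rule integral_mono)
          show "integrable lborel (\<lambda>x. indicator K x *\<^sub>R w x)"
            by (rule borel_integrable_compact[OF K(1) contw[OF K(3)]])
          show "integrable lborel (\<lambda>x. \<bar>f x0\<bar>^3 * (indicator K x *\<^sub>R ?v x))" using i by simp
          fix x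
          show "indicator K x *\<^sub>R w x \<le> \<bar>f x0\<bar>^3 * (indicator K x *\<^sub>R ?v x)"
          proof (cases "x \<in> A \<inter> K")
            case True
            then have "\<bar>f x\<bar>^3 * \<bar>f x\<bar> \<le> \<bar>f x0\<bar>^3 * \<bar>f x\<bar>"
              using mx K(3) by (intro mult_right_mono power_mono) auto
            moreover have "\<bar>f x\<bar>^3 * \<bar>f x\<bar> = f x ^ 4"
              by (simp add: power4_eq_xxxx power3_eq_cube abs_mult[symmetric] mult.assoc)
            ultimately show ?thesis using True by (simp add: w_def)
          qed (auto simp: w_def indicator_def)
        qed
        also have "\<dots> = \<bar>f x0\<bar>^3 * ?I"
          by (simp only: integral_mult_right_zero eqv set_lebesgue_integral_def)
        finally show ?thesis .
      qed
      finally show ?thesis using R by (simp add: divide_right_mono)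
    qed
    with low have "m * (c0 / 2) \<le> \<bar>f x0\<bar>^3 * ?I / R ^ CARD('n)" by (rule order_trans)
    moreover have "R ^ CARD('n) = \<epsilon> ^ CARD('n) / \<mu> powr (?N / 2)"
    proof -
      have "sqrt \<mu> ^ CARD('n) = \<mu> powr (?N / 2)"
        using \<mu>0 by (simp add: powr_half_sqrt[symmetric] powr_powr powr_realpow[symmetric])
      then show ?thesis by (simp add: R_def power_divide)
    qed
    moreover have "m * (c0 / 2) = \<bar>f x0\<bar>^3 * (\<bar>f x0\<bar> * (c0 / 2))"
      by (simp add: m_def power4_eq_xxxx power3_eq_cube abs_mult[symmetric] mult.assoc)
    ultimately have fin: "\<bar>f x0\<bar>^3 * (\<bar>f x0\<bar> * (c0 / 2)) \<le> \<bar>f x0\<bar>^3 * (?I * \<mu> powr (?N / 2) / \<epsilon> ^ CARD('n))"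
      using c0 by (simp add: mult.assoc)
    have I0: "0 \<le> ?I" by (simp add: set_lebesgue_integral_def)
    have "\<bar>f x0\<bar> * (c0 / 2) \<le> ?I * \<mu> powr (?N / 2) / \<epsilon> ^ CARD('n)"
    proof (cases "f x0 = 0")
      case False
      then show ?thesis by (intro mult_left_le_imp_le[OF fin]) simp
    qed (use I0 \<epsilon> in simp)
    then show "\<bar>f x0\<bar> \<le> 2 / (c0 * \<epsilon> ^ CARD('n)) * \<mu> powr (?N / 2) * (LINT x:A \<inter> cball xc (2 * r)|lborel. \<bar>f x\<bar>)"
      using c0 \<epsilon> by (simp add: K_def field_simps)
  qed
qed

section \<open>Nodal domains\<close>

context smooth_manifold
begin

lemma chart_facts:
  assumes "c \<in> \<A>"
  shows "openin (top_of_set M) (fst c)" "open (chart_image c)" "fst c \<subseteq> M"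
    "homeomorphism (fst c) (chart_image c) (snd c) (chart_inv c)"
    "\<And>p. p \<in> fst c \<Longrightarrow> snd c p \<in> chart_image c" "\<And>p. p \<in> fst c \<Longrightarrow> chart_inv c (snd c p) = p"
    "\<And>x. x \<in> chart_image c \<Longrightarrow> chart_inv c x \<in> fst c" "\<And>x. x \<in> chart_image c \<Longrightarrow> snd c (chart_inv c x) = x"
    "continuous_on (chart_image c) (chart_inv c)" "continuous_on (fst c) (snd c)"
proof -
  show *: "openin (top_of_set M) (fst c)" "open (chart_image c)"
    "homeomorphism (fst c) (chart_image c) (snd c) (chart_inv c)"
    using charts[OF assms] by (simp_all add: chart_on_def)
  show "fst c \<subseteq> M" using *(1) by (rule openin_imp_subset)
  show "snd c p \<in> chart_image c" "chart_inv c (snd c p) = p" if "p \<in> fst c" for p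
    using *(3) that by (auto simp: homeomorphism_def)
  show "chart_inv c x \<in> fst c" "snd c (chart_inv c x) = x" if "x \<in> chart_image c" for x
    using *(3) that by (auto simp: homeomorphism_def)
  show "continuous_on (chart_image c) (chart_inv c)" "continuous_on (fst c) (snd c)"
    using *(3) by (simp_all add: homeomorphism_def)
qed

lemma openin_chart_preimage:
  assumes c: "c \<in> \<A>" and V: "open V" "V \<subseteq> chart_image c"
  shows "openin (top_of_set M) (chart_inv c ` V)"
proof -
  have "openin (top_of_set (chart_image c)) V"
    using V chart_facts(2)[OF c] by (simp add: openin_open_eq)
  from homeomorphism_imp_open_map[OF homeomorphism_symD[OF chart_facts(4)[OF c]] this]
  show ?thesis using chart_facts(1)[OF c] openin_trans by blast
qed

lemma open_chart_restriction:
  assumes c: "c \<in> \<A>" and A: "openin (top_of_set M) A"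
  shows "open (snd c ` (A \<inter> fst c))"
proof -
  have "openin (top_of_set (fst c)) (A \<inter> fst c)"
    using A chart_facts(1,3)[OF c] by (meson inf_le2 openin_Int openin_subset_trans)
  from homeomorphism_imp_open_map[OF chart_facts(4)[OF c] this]
  show ?thesis using chart_facts(2)[OF c] openin_open_trans by blast
qed

text \<open>The factor 2 leaves room for a ball of radius \<open>r\<close> about every point of the
  inner ball, where the maximum point may lie.\<close>

lemma exists_chart_ball:
  assumes "p \<in> M"
  obtains c r where "c \<in> \<A>" "p \<in> fst c" "r > 0" "cball (snd c p) (2 * r) \<subseteq> chart_image c"
proof -
  obtain c where c: "c \<in> \<A>" "p \<in> fst c" using assms cover by blast
  obtain e where "e > 0" "cball (snd c p) e \<subseteq> chart_image c"
    using chart_facts(2,5)[OF c(1)] c(2) open_contains_cball by metis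
  then show ?thesis using that[OF c, of "e / 2"] by simp
qed

lemma smooth_function_continuous_on:
  assumes "smooth_function \<A> u"
  shows "continuous_on M u"
proof -
  have "continuous_on (fst c) u" if c: "c \<in> \<A>" for c
  proof -
    have "Ck_on 0 (chart_image c) (u \<circ> chart_inv c)"
      using assms c unfolding smooth_function_def smooth_on_def by blast
    then have "continuous_on (chart_image c) (u \<circ> chart_inv c)" by simp
    then have "continuous_on (fst c) (\<lambda>p. (u \<circ> chart_inv c) (snd c p))"
      by (rule continuous_on_compose2[OF _ chart_facts(10)[OF c]]) (use chart_facts(5)[OF c] in auto)
    then show ?thesis
      by (rule continuous_on_eq) (simp add: chart_facts(6)[OF c])
  qed
  moreover have "\<exists>c\<in>\<A>. p \<in> fst c \<and> at p within fst c = at p within M" if "p \<in> M" for p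
  proof -
    obtain c where c: "c \<in> \<A>" "p \<in> fst c" using \<open>p \<in> M\<close> cover by blast
    obtain T where "open T" "fst c = M \<inter> T"
      using chart_facts(1)[OF c(1)] by (auto simp: openin_open)
    then have "at p within fst c = at p within M"
      using c(2) by (intro at_within_nhd[of p T]) auto
    then show ?thesis using c by blast
  qed
  ultimately show ?thesis
    unfolding continuous_on_def by metis
qed

text \<open>The last item is the working form of maximality: the union of \<open>A\<close> with a
  connected set that meets it is connected, so \<open>A\<close> absorbs every such open set without
  zeros.\<close>

lemma nodal_domain_facts:
  assumes "A \<in> nodal_domains M u"
  shows "A \<noteq> {}" "openin (top_of_set M) A" "connected A" "A \<subseteq> M" "\<And>p. p \<in> A \<Longrightarrow> u p \<noteq> 0"
    "\<And>B. openin (top_of_set M) B \<Longrightarrow> connected B \<Longrightarrow> (\<And>p. p \<in> B \<Longrightarrow> u p \<noteq> 0) \<Longrightarrow> A \<inter> B \<noteq> {} \<Longrightarrow> B \<subseteq> A"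
proof -
  show A: "A \<noteq> {}" "openin (top_of_set M) A" "connected A" "\<And>p. p \<in> A \<Longrightarrow> u p \<noteq> 0"
    using assms by (auto simp: nodal_domains_def)
  then show "A \<subseteq> M" by (simp add: openin_imp_subset)
  fix B assume B: "openin (top_of_set M) B" "connected B" "\<And>p. p \<in> B \<Longrightarrow> u p \<noteq> 0" "A \<inter> B \<noteq> {}"
  then have "openin (top_of_set M) (A \<union> B)" "connected (A \<union> B)" "\<forall>p\<in>A \<union> B. u p \<noteq> 0"
    using A by (auto intro: connected_Un)
  then have "A \<union> B = A"
    using assms by (auto simp: nodal_domains_def)
  then show "B \<subseteq> A" by blast
qed

lemma nodal_domains_disjoint:
  assumes "A \<in> nodal_domains M u" "B \<in> nodal_domains M u" "A \<inter> B \<noteq> {}"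
  shows "A = B"
proof
  show "A \<subseteq> B"
    by (rule nodal_domain_facts(6)[OF assms(2)]) (use assms nodal_domain_facts[OF assms(1)] in auto)
  show "B \<subseteq> A"
    by (rule nodal_domain_facts(6)[OF assms(1)]) (use assms nodal_domain_facts[OF assms(2)] in auto)
qed

text \<open>Coordinate balls are connected; through them the charts provide the local connectedness
  that arguments by maximality need.\<close>

lemma connected_nonzero_neighbourhood:
  assumes u: "continuous_on M u" and c: "c \<in> \<A>" and x: "x \<in> chart_image c" and nz: "u (chart_inv c x) \<noteq> (0::real)"
  obtains V where "open V" "x \<in> V" "V \<subseteq> chart_image c" "connected (chart_inv c ` V)"
    "\<And>p. p \<in> chart_inv c ` V \<Longrightarrow> u p \<noteq> 0"
proof -
  have "continuous_on (chart_image c) (\<lambda>x. u (chart_inv c x))"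
    by (rule continuous_on_compose2[OF u chart_facts(9)[OF c]]) (use chart_facts(3,7)[OF c] in auto)
  then have "open (chart_image c \<inter> (\<lambda>x. u (chart_inv c x)) -` (- {0}))"
    by (rule continuous_open_preimage[OF _ chart_facts(2)[OF c]]) auto
  moreover have "x \<in> chart_image c \<inter> (\<lambda>x. u (chart_inv c x)) -` (- {0})" using x nz by simp
  ultimately obtain e where e: "e > 0" "ball x e \<subseteq> chart_image c \<inter> (\<lambda>x. u (chart_inv c x)) -` (- {0})"
    using openE by blast
  have "connected (chart_inv c ` ball x e)"
    by (intro connected_continuous_image continuous_on_subset[OF chart_facts(9)[OF c]]) (use e in auto)
  then show ?thesis using e by (intro that[of "ball x e"]) auto
qed

text \<open>A boundary point with \<open>u \<noteq> 0\<close> would have a connected neighbourhood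
  without zeros that meets \<open>A\<close> and is therefore absorbed by it. The closure is taken in
  coordinates, as the cutoff lemmas require.\<close>

lemma nodal_domain_boundary_chart:
  assumes u: "continuous_on M u" and A: "A \<in> nodal_domains M u" and c: "c \<in> \<A>"
    and x: "x \<in> chart_image c" "x \<in> closure (snd c ` (A \<inter> fst c))" "x \<notin> snd c ` (A \<inter> fst c)"
  shows "u (chart_inv c x) = 0"
proof (rule ccontr)
  assume "u (chart_inv c x) \<noteq> 0"
  from connected_nonzero_neighbourhood[OF u c x(1) this] obtain V where
    V: "open V" "x \<in> V" "V \<subseteq> chart_image c" "connected (chart_inv c ` V)" "\<And>p. p \<in> chart_inv c ` V \<Longrightarrow> u p \<noteq> 0"
    by blast
  obtain p where p: "p \<in> A" "p \<in> fst c" "snd c p \<in> V"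
    using x(2) V(1,2) by (auto simp: closure_iff_nhds_not_empty)
  then have "p \<in> chart_inv c ` V" using chart_facts(6)[OF c] by force
  then have "chart_inv c ` V \<subseteq> A"
    using p V by (intro nodal_domain_facts(6)[OF A] openin_chart_preimage[OF c]) auto
  then have "chart_inv c x \<in> A \<inter> fst c" using V(2) chart_facts(7)[OF c x(1)] by auto
  then show False using x(3) chart_facts(8)[OF c x(1)] by force
qed

text \<open>The same argument for the closure in the ambient space, which is the one used to find a
  maximum point by compactness of \<open>M\<close>.\<close>

lemma nodal_domain_boundary:
  assumes u: "continuous_on M u" and A: "A \<in> nodal_domains M u"
    and p: "p \<in> M" "p \<in> closure A" "p \<notin> A"
  shows "u p = 0"
proof (rule ccontr)
  assume nz: "u p \<noteq> 0"
  obtain c where c: "c \<in> \<A>" "p \<in> fst c" using p(1) cover by blast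
  have "u (chart_inv c (snd c p)) \<noteq> 0" using nz chart_facts(6)[OF c] by simp
  from connected_nonzero_neighbourhood[OF u c(1) chart_facts(5)[OF c] this] obtain V where
    V: "open V" "snd c p \<in> V" "V \<subseteq> chart_image c" "connected (chart_inv c ` V)" "\<And>p. p \<in> chart_inv c ` V \<Longrightarrow> u p \<noteq> 0"
    by blast
  have N: "openin (top_of_set M) (chart_inv c ` V)" "p \<in> chart_inv c ` V"
    using openin_chart_preimage[OF c(1) V(1,3)] V(2) chart_facts(6)[OF c] by force+
  then obtain T where T: "open T" "chart_inv c ` V = M \<inter> T" by (auto simp: openin_open)
  then have "T \<inter> A \<noteq> {}"
    using p(2) N(2) by (auto simp: closure_iff_nhds_not_empty)
  then have "A \<inter> chart_inv c ` V \<noteq> {}" using T nodal_domain_facts(4)[OF A] by blast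
  then have "chart_inv c ` V \<subseteq> A"
    using V by (intro nodal_domain_facts(6)[OF A] N) auto
  then show False using N p(3) by blast
qed

lemma nodal_domain_max:
  assumes M: "compact M" and u: "continuous_on M u" and A: "A \<in> nodal_domains M u"
  obtains p where "p \<in> A" "\<And>q. q \<in> A \<Longrightarrow> \<bar>u q\<bar> \<le> \<bar>u p\<bar>"
proof -
  have "compact (M \<inter> closure A)" using M by (rule compact_Int_closed) simp
  moreover have sub: "A \<subseteq> M \<inter> closure A" using nodal_domain_facts(4)[OF A] closure_subset by auto
  moreover have "continuous_on (M \<inter> closure A) (\<lambda>p. \<bar>u p\<bar>)"
    by (intro continuous_intros continuous_on_subset[OF u]) auto
  ultimately obtain p where p: "p \<in> M \<inter> closure A" "\<forall>q\<in>M \<inter> closure A. \<bar>u q\<bar> \<le> \<bar>u p\<bar>"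
    using continuous_attains_sup[of "M \<inter> closure A" "\<lambda>p. \<bar>u p\<bar>"] nodal_domain_facts(1)[OF A] by blast
  obtain q where "q \<in> A" using nodal_domain_facts(1)[OF A] by blast
  then have "u q \<noteq> 0" "\<bar>u q\<bar> \<le> \<bar>u p\<bar>" using nodal_domain_facts(5)[OF A] p(2) sub by auto
  then have "p \<in> A" using nodal_domain_boundary[OF u A] p(1) by force
  then show ?thesis using p(2) sub by (intro that) auto
qed

end

text \<open>Applied to \<open>\<bar>u\<bar>\<close> in coordinates for the sum of the maxima, and to
  the constant 1 for the number of domains.\<close>

lemma sum_set_integral_disjoint_le:
  fixes h :: "'b::euclidean_space \<Rightarrow> real"
  assumes \<F>: "finite \<F>" "disjoint_family_on T \<F>" "\<And>A. A \<in> \<F> \<Longrightarrow> open (T A)"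
    and K: "compact K" and h: "continuous_on K h" "\<And>x. x \<in> K \<Longrightarrow> 0 \<le> h x"
  shows "(\<Sum>A\<in>\<F>. LINT x:T A \<inter> K|lborel. h x) \<le> (LINT x:K|lborel. h x)"
proof -
  have iK: "integrable lborel (\<lambda>x. indicator K x *\<^sub>R h x)" by (rule borel_integrable_compact[OF K h(1)])
  have eq: "indicator (T A \<inter> K) x *\<^sub>R h x = indicator (T A) x *\<^sub>R (indicator K x *\<^sub>R h x)" for A x
    by (simp add: indicator_inter_arith)
  have i: "integrable lborel (\<lambda>x. indicator (T A \<inter> K) x *\<^sub>R h x)" if "A \<in> \<F>" for A
    unfolding eq by (rule integrable_mult_indicator[OF _ iK]) (use \<F>(3)[OF that] in simp)
  have "(\<Sum>A\<in>\<F>. LINT x:T A \<inter> K|lborel. h x) = (\<integral>x. (\<Sum>A\<in>\<F>. indicator (T A \<inter> K) x *\<^sub>R h x) \<partial>lborel)"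
    unfolding set_lebesgue_integral_def using i by (simp add: integral_sum)
  also have "\<dots> \<le> (LINT x:K|lborel. h x)"
    unfolding set_lebesgue_integral_def
  proof (rule integral_mono[OF _ iK])
    show "integrable lborel (\<lambda>x. \<Sum>A\<in>\<F>. indicator (T A \<inter> K) x *\<^sub>R h x)" using i by simp
    fix x
    have "(\<Sum>A\<in>\<F>. indicator (T A \<inter> K) x *\<^sub>R h x) = indicator (\<Union>A\<in>\<F>. T A) x * (indicator K x *\<^sub>R h x)"
      unfolding eq by (simp add: indicator_UN_disjoint[OF \<F>(1,2)] sum_distrib_right)
    also have "\<dots> \<le> indicator K x *\<^sub>R h x"
      using h(2) by (auto simp: indicator_def)
    finally show "(\<Sum>A\<in>\<F>. indicator (T A \<inter> K) x *\<^sub>R h x) \<le> indicator K x *\<^sub>R h x" .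
  qed
  finally show ?thesis .
qed

section \<open>Volume and the global sum\<close>

context riemannian_manifold
begin

lemma C1_on_metric_component:
  assumes "c \<in> \<A>"
  shows "C1_on (chart_image c) (\<lambda>x. g c x $ i $ j)"
proof -
  have "Ck_on 1 (chart_image c) (g c)"
    using smooth[OF assms] by (simp add: smooth_on_def)
  moreover have "bounded_linear (\<lambda>B :: real^'n^'n. B $ i $ j)"
    using bounded_linear_compose[OF bounded_linear_vec_nth bounded_linear_vec_nth] .
  ultimately show ?thesis
    by (intro C1_on_if_Ck_on[of 0] Ck_on_bounded_linear)
qed

lemma volume_density_pos:
  assumes "c \<in> \<A>" "x \<in> chart_image c"
  shows "0 < volume_density g c x"
  using det_pos_definite[OF positive_definite[OF assms]] by (simp add: volume_density_def)

lemma continuous_on_volume_density: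
  assumes "c \<in> \<A>"
  shows "continuous_on (chart_image c) (volume_density g c)"
  unfolding volume_density_def[abs_def]
  by (intro continuous_on_real_sqrt C1_on_continuous C1_on_det C1_on_metric_component[OF assms])

lemma nodal_max_chart_estimate:
  assumes c: "c \<in> \<A>" and r: "0 < r" "cball y (2 * r) \<subseteq> chart_image c"
  shows "\<exists>C>0. \<exists>\<mu>0>0. \<forall>\<mu>\<ge>\<mu>0. \<forall>u A p. eigenfunction M \<A> g \<mu> u \<longrightarrow> A \<in> nodal_domains M u \<longrightarrow>
    p \<in> A \<inter> fst c \<longrightarrow> snd c p \<in> cball y r \<longrightarrow> (\<forall>q\<in>A. \<bar>u q\<bar> \<le> \<bar>u p\<bar>) \<longrightarrow>
    \<bar>u p\<bar> \<le> C * \<mu> powr (real CARD('n) / 2) *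
      (LINT x:snd c ` (A \<inter> fst c) \<inter> cball y (2 * r)|lborel. \<bar>u (chart_inv c x)\<bar>)"
proof -
  note \<Omega> = chart_facts(2)[OF c]
  show ?thesis
  \<comment> \<open>The constants of \<open>max_le_local_average\<close> are kept; only the
    statement under the quantifiers is translated to the manifold.\<close>
  proof (rule ex_forward, rule max_le_local_average[OF \<Omega> r, where G="g c"], rule C1_on_metric_component[OF c],
      erule symmetric[OF c], erule positive_definite[OF c], assumption,
      erule conj_forward, assumption, erule ex_forward, erule conj_forward, assumption, intro allI impI, goal_cases)
    case (1 C \<mu>0 \<mu> u A p)
    note est = 1(1) and \<mu> = 1(2) and u = 1(3) and A = 1(4) and p = 1(5,6) and mx = 1(7)
    have su: "smooth_function \<A> u" using u by (simp add: eigenfunction_def)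
    define f where "f = u \<circ> chart_inv c"
    have f: "Ck_on (Suc 0) (chart_image c) f" "Ck_on (Suc (Suc 0)) (chart_image c) f"
      using su c unfolding smooth_function_def smooth_on_def f_def by blast+
    have "\<bar>f (snd c p)\<bar> \<le> C * \<mu> powr (real CARD('n) / 2) *
      (LINT x:snd c ` (A \<inter> fst c) \<inter> cball y (2 * r)|lborel. \<bar>f x\<bar>)"
    proof (rule est[rule_format, OF \<mu> C1_on_if_Ck_on[OF f(1)] C1_on_partial_if_Ck_on[OF f(2)]])
      show "open (snd c ` (A \<inter> fst c))"
        by (rule open_chart_restriction[OF c nodal_domain_facts(2)[OF A]])
      show "f x = 0" if "x \<in> chart_image c" "x \<in> closure (snd c ` (A \<inter> fst c))" "x \<notin> snd c ` (A \<inter> fst c)" for x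
        using nodal_domain_boundary_chart[OF smooth_function_continuous_on[OF su] A c that] by (simp add: f_def)
      show "snd c p \<in> snd c ` (A \<inter> fst c) \<inter> cball y r" using p by blast
      show "\<bar>f x\<bar> \<le> \<bar>f (snd c p)\<bar>" if "x \<in> snd c ` (A \<inter> fst c) \<inter> chart_image c" for x
        using that mx p chart_facts(6)[OF c] by (auto simp: f_def)
      show "(\<Sum>i\<in>UNIV. partial i (\<lambda>x. sqrt (det (g c x)) * (matrix_inv (g c x) *v grad f x) $ i) x)
        = - (\<mu> * sqrt (det (g c x)) * f x)" if x: "x \<in> chart_image c" for x
      proof -
        \<comment> \<open>Multiplication by the volume density clears the denominator in
          \<open>divergence\<close> and leaves the equation in divergence form.\<close>
        have "laplacian g c u (snd c (chart_inv c x)) = \<mu> * u (chart_inv c x)"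
          using u c chart_facts(7)[OF c x] by (simp add: eigenfunction_def)
        then have "laplacian g c u x = \<mu> * f x"
          by (simp add: chart_facts(8)[OF c x] f_def)
        then show ?thesis
          using volume_density_pos[OF c x]
          by (simp add: laplacian_def divergence_def gradient_def volume_density_def grad_def f_def[symmetric] field_simps)
      qed
    qed
    then show "\<bar>u p\<bar> \<le> C * \<mu> powr (real CARD('n) / 2) *
      (LINT x:snd c ` (A \<inter> fst c) \<inter> cball y (2 * r)|lborel. \<bar>u (chart_inv c x)\<bar>)"
      using p(1) chart_facts(6)[OF c] by (simp add: f_def)
  qed
qed

lemma sets_chart_volume: "sets (chart_volume M g c) = sets (restrict_space borel M)"
  by (simp add: chart_volume_def)

lemma sets_riemannian_volume:
  assumes "\<A> \<noteq> {}"
  shows "sets (riemannian_volume M \<A> g) = sets (restrict_space borel M)"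
  unfolding riemannian_volume_def
  by (rule sets_SUP) (use assms sets_chart_volume in auto)

text \<open>The integral of the square against the chart volume is at most the one against the
  Riemannian volume, which is 1. On \<open>K\<close> the density is at least some
  \<open>\<beta> > 0\<close>, so \<open>1 / \<beta>\<close> bounds the Lebesgue integral.\<close>

lemma chart_l2_bound:
  assumes c: "c \<in> \<A>" and K: "compact K" "K \<subseteq> chart_image c"
  shows "\<exists>D\<ge>0. \<forall>u. smooth_function \<A> u \<longrightarrow> l2_norm (riemannian_volume M \<A> g) u = 1 \<longrightarrow>
    (LINT x:K|lborel. (u (chart_inv c x))\<^sup>2) \<le> D"
proof -
  let ?\<Omega> = "chart_image c" and ?v = "volume_density g c" and ?\<nu> = "riemannian_volume M \<A> g"
  obtain \<beta> where \<beta>: "\<beta> > 0" "\<And>x. x \<in> K \<Longrightarrow> \<beta> \<le> ?v x"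
  proof (cases "K = {}")
    case False
    then obtain z where "z \<in> K" "\<forall>x\<in>K. ?v z \<le> ?v x"
      using continuous_attains_inf[OF K(1) _ continuous_on_subset[OF continuous_on_volume_density[OF c] K(2)]] by blast
    then show ?thesis using volume_density_pos[OF c, of z] K(2) by (intro that[of "?v z"]) auto
  qed (use that[of 1] in auto)
  have "(LINT x:K|lborel. (u (chart_inv c x))\<^sup>2) \<le> 1 / \<beta>"
    if u: "smooth_function \<A> u" and n: "l2_norm ?\<nu> u = 1" for u
  proof -
    have cu: "continuous_on ?\<Omega> (\<lambda>x. u (chart_inv c x))"
      by (rule continuous_on_compose2[OF smooth_function_continuous_on[OF u] chart_facts(9)[OF c]])
         (use chart_facts(3,7)[OF c] in auto)
    have I: "(\<integral>p. (u p)\<^sup>2 \<partial>?\<nu>) = 1" using n by (simp add: l2_norm_def)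
    \<comment> \<open>Integrability is read off from the value: the Bochner integral of a function
      that is not integrable is 0, not 1.\<close>
    then have int: "integrable ?\<nu> (\<lambda>p. (u p)\<^sup>2)"
      using not_integrable_integral_eq by fastforce
    have one: "(\<integral>\<^sup>+p. ennreal ((u p)\<^sup>2) \<partial>?\<nu>) = 1"
      using nn_integral_eq_integral[OF int] I by simp
    have setseq: "sets ?\<nu> = sets (restrict_space borel M)"
      using sets_riemannian_volume c by auto
    have meas: "(\<lambda>p. ennreal ((u p)\<^sup>2)) \<in> borel_measurable (restrict_space borel M)"
      using borel_measurable_integrable[OF int] measurable_cong_sets[OF setseq refl] by auto
    have "chart_volume M g c \<le> ?\<nu>"
      unfolding riemannian_volume_def by (rule SUP_upper[OF c])
    then have "(\<integral>\<^sup>+p. ennreal ((u p)\<^sup>2) \<partial>chart_volume M g c) \<le> 1"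
      using nn_integral_mono_measure[of "chart_volume M g c" ?\<nu> "\<lambda>p. ennreal ((u p)\<^sup>2)"] one setseq sets_chart_volume
      by simp
    also have "(\<integral>\<^sup>+p. ennreal ((u p)\<^sup>2) \<partial>chart_volume M g c) =
      (\<integral>\<^sup>+x. ennreal ((u (chart_inv c x))\<^sup>2) \<partial>density (restrict_space lborel ?\<Omega>) (\<lambda>x. ennreal (?v x)))"
      unfolding chart_volume_def
    proof (rule nn_integral_distr)
      show "(\<lambda>p. ennreal ((u p)\<^sup>2)) \<in> borel_measurable (distr (density (restrict_space lborel ?\<Omega>) (\<lambda>x. ennreal (?v x)))
          (restrict_space borel M) (chart_inv c))"
        using meas by simp
      have "chart_inv c \<in> restrict_space borel ?\<Omega> \<rightarrow>\<^sub>M restrict_space borel M"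
        by (intro measurable_restrict_space2 borel_measurable_continuous_on_restrict chart_facts(9)[OF c])
           (use chart_facts(3,7)[OF c] in \<open>auto simp: space_restrict_space\<close>)
      then show "chart_inv c \<in> density (restrict_space lborel ?\<Omega>) (\<lambda>x. ennreal (?v x)) \<rightarrow>\<^sub>M restrict_space borel M"
        by (simp cong: measurable_cong_sets add: sets_restrict_space)
    qed
    also have "\<dots> = (\<integral>\<^sup>+x. ennreal (?v x) * ennreal ((u (chart_inv c x))\<^sup>2) \<partial>restrict_space lborel ?\<Omega>)"
    proof (rule nn_integral_density)
      have "?v \<in> borel_measurable (restrict_space borel ?\<Omega>)"
        "(\<lambda>x. (u (chart_inv c x))\<^sup>2) \<in> borel_measurable (restrict_space borel ?\<Omega>)"
        by (intro borel_measurable_continuous_on_restrict continuous_intros cu continuous_on_volume_density[OF c])+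
      then show "(\<lambda>x. ennreal (?v x)) \<in> borel_measurable (restrict_space lborel ?\<Omega>)"
        "(\<lambda>x. ennreal ((u (chart_inv c x))\<^sup>2)) \<in> borel_measurable (restrict_space lborel ?\<Omega>)"
        by (simp_all cong: measurable_cong_sets add: sets_restrict_space)
    qed
    also have "\<dots> = (\<integral>\<^sup>+x. ennreal (?v x) * ennreal ((u (chart_inv c x))\<^sup>2) * indicator ?\<Omega> x \<partial>lborel)"
      using chart_facts(2)[OF c] by (subst nn_integral_restrict_space) auto
    finally have le1: "\<dots> \<le> 1" .
    have iK: "integrable lborel (\<lambda>x. indicator K x *\<^sub>R (u (chart_inv c x))\<^sup>2)"
      by (intro borel_integrable_compact K(1) continuous_intros continuous_on_subset[OF cu K(2)])
    have "ennreal (\<beta> * (LINT x:K|lborel. (u (chart_inv c x))\<^sup>2)) =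
      (\<integral>\<^sup>+x. ennreal (\<beta> * (indicator K x *\<^sub>R (u (chart_inv c x))\<^sup>2)) \<partial>lborel)"
      unfolding set_lebesgue_integral_def
      using iK \<beta>(1) by (subst nn_integral_eq_integral) (auto simp: indicator_def)
    also have "\<dots> \<le> (\<integral>\<^sup>+x. ennreal (?v x) * ennreal ((u (chart_inv c x))\<^sup>2) * indicator ?\<Omega> x \<partial>lborel)"
    proof (rule nn_integral_mono)
      fix x
      show "ennreal (\<beta> * (indicator K x *\<^sub>R (u (chart_inv c x))\<^sup>2)) \<le>
        ennreal (?v x) * ennreal ((u (chart_inv c x))\<^sup>2) * indicator ?\<Omega> x"
      proof (cases "x \<in> K")
        case True
        then have "ennreal (\<beta> * (u (chart_inv c x))\<^sup>2) \<le> ennreal (?v x * (u (chart_inv c x))\<^sup>2)"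
          using \<beta> by (intro ennreal_leI mult_right_mono) auto
        then show ?thesis
          using True K(2) volume_density_pos[OF c, of x] by (auto simp: ennreal_mult)
      qed simp
    qed
    also note le1
    finally have "\<beta> * (LINT x:K|lborel. (u (chart_inv c x))\<^sup>2) \<le> 1" by simp
    then show ?thesis using \<beta>(1) by (simp add: field_simps)
  qed
  then show ?thesis using \<beta>(1) by (intro exI[of _ "1 / \<beta>"]) auto
qed

text \<open>Because \<open>K\<close> has finite measure and the norm is fixed to 1, the pointwise
  bound \<open>\<bar>t\<bar> \<le> 1 + t\<^sup>2\<close> does the work of the Cauchy-Schwarz
  inequality.\<close>

lemma chart_l1_bound:
  assumes c: "c \<in> \<A>" and K: "compact K" "K \<subseteq> chart_image c"
  shows "\<exists>D\<ge>0. \<forall>u. smooth_function \<A> u \<longrightarrow> l2_norm (riemannian_volume M \<A> g) u = 1 \<longrightarrow>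
    (LINT x:K|lborel. \<bar>u (chart_inv c x)\<bar>) \<le> D"
proof -
  obtain D where D: "D \<ge> 0" "\<And>u. smooth_function \<A> u \<Longrightarrow> l2_norm (riemannian_volume M \<A> g) u = 1 \<Longrightarrow>
    (LINT x:K|lborel. (u (chart_inv c x))\<^sup>2) \<le> D"
    using chart_l2_bound[OF assms] by blast
  let ?V = "LINT x:K|lborel. (1::real)"
  have V: "?V \<ge> 0" by (simp add: set_lebesgue_integral_def)
  have "(LINT x:K|lborel. \<bar>u (chart_inv c x)\<bar>) \<le> ?V + D"
    if u: "smooth_function \<A> u" "l2_norm (riemannian_volume M \<A> g) u = 1" for u
  proof -
    have cu: "continuous_on K (\<lambda>x. u (chart_inv c x))"
      by (rule continuous_on_compose2[OF smooth_function_continuous_on[OF u(1)] continuous_on_subset[OF chart_facts(9)[OF c] K(2)]])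
         (use chart_facts(3,7)[OF c] K(2) in auto)
    have i: "integrable lborel (\<lambda>x. indicator K x *\<^sub>R \<bar>u (chart_inv c x)\<bar>)"
      "integrable lborel (\<lambda>x. indicator K x *\<^sub>R (1::real))"
      "integrable lborel (\<lambda>x. indicator K x *\<^sub>R (u (chart_inv c x))\<^sup>2)"
      by (intro borel_integrable_compact K(1) continuous_intros cu)+
    have "t \<le> 1 + t\<^sup>2" if "t \<ge> 0" for t :: real
      using sum_squares_bound[of 1 t] that by simp
    then have b: "\<bar>t\<bar> \<le> 1 + t\<^sup>2" for t :: real
      by (metis abs_ge_zero power2_abs)
    have "(LINT x:K|lborel. \<bar>u (chart_inv c x)\<bar>) \<le>
      (\<integral>x. indicator K x *\<^sub>R (1::real) + indicator K x *\<^sub>R (u (chart_inv c x))\<^sup>2 \<partial>lborel)"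
      unfolding set_lebesgue_integral_def
      by (intro integral_mono i Bochner_Integration.integrable_add) (auto simp: indicator_def b)
    also have "\<dots> = ?V + (LINT x:K|lborel. (u (chart_inv c x))\<^sup>2)"
      unfolding set_lebesgue_integral_def by (rule Bochner_Integration.integral_add[OF i(2,3)])
    finally show ?thesis using D(2)[OF u] by simp
  qed
  then show ?thesis using D(1) V by (intro exI[of _ "?V + D"]) auto
qed

end

section \<open>Finite cover and summation over the nodal domains\<close>

theorem corollary1p3p4:
  fixes M :: "'a::t2_space set"
    and \<A> :: "('a, 'n::finite) chart set"
    and g :: "('a, 'n) chart \<Rightarrow> real^'n \<Rightarrow> real^'n^'n"
  assumes "riemannian_manifold M \<A> g"
    and "compact M"
    and "connected M"
  shows "\<exists>\<mu>\<^sub>0>0. \<exists>k>0. \<forall>\<mu>\<ge>\<mu>\<^sub>0. eigenvalue M \<A> g \<mu> \<longrightarrow>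
    (\<forall>u. eigenfunction M \<A> g \<mu> u \<and> l2_norm (riemannian_volume M \<A> g) u = 1 \<longrightarrow>
      finite (nodal_domains M u) \<and>
      (\<Sum>A\<in>nodal_domains M u. nodal_max u A) \<le> k * \<mu> powr (real CARD('n) / 2))"
proof -
  interpret riemannian_manifold M \<A> g by fact
  \<comment> \<open>A coordinate piece, its constants and both estimates are packed into one
    predicate, so that constants independent of \<mu> and \<open>u\<close> can be chosen for each
    member of a finite subcover.\<close>
  define est where "est c y r C m D \<longleftrightarrow> c \<in> \<A> \<and> cball y (2 * r) \<subseteq> chart_image c \<and> C > 0 \<and> m > 0 \<and> D \<ge> 0 \<and> 0 < r \<and>
    (\<forall>\<mu>\<ge>m. \<forall>u A p. eigenfunction M \<A> g \<mu> u \<longrightarrow> A \<in> nodal_domains M u \<longrightarrow>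
      p \<in> A \<inter> fst c \<longrightarrow> snd c p \<in> cball y r \<longrightarrow> (\<forall>q\<in>A. \<bar>u q\<bar> \<le> \<bar>u p\<bar>) \<longrightarrow>
      \<bar>u p\<bar> \<le> C * \<mu> powr (real CARD('n) / 2) *
        (LINT x:snd c ` (A \<inter> fst c) \<inter> cball y (2 * r)|lborel. \<bar>u (chart_inv c x)\<bar>)) \<and>
    (\<forall>u. smooth_function \<A> u \<longrightarrow> l2_norm (riemannian_volume M \<A> g) u = 1 \<longrightarrow>
      (LINT x:cball y (2 * r)|lborel. \<bar>u (chart_inv c x)\<bar>) \<le> D)" for c y r C m D
  define \<N> where "\<N> = {N. \<exists>c y r C m D. est c y r C m D \<and> N = chart_inv c ` ball y r}"
  have "\<forall>N\<in>\<N>. openin (top_of_set M) N"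
  proof
    fix N assume "N \<in> \<N>"
    then obtain c y r where c: "c \<in> \<A>" "cball y (2 * r) \<subseteq> chart_image c" "0 < r" "N = chart_inv c ` ball y r"
      unfolding \<N>_def est_def by blast
    have "ball y r \<subseteq> cball y (2 * r)" using c(3) by auto
    then show "openin (top_of_set M) N"
      using c openin_chart_preimage by auto
  qed
  moreover have "M \<subseteq> \<Union>\<N>"
  proof
    fix p assume "p \<in> M"
    then obtain c r where c: "c \<in> \<A>" "p \<in> fst c" "r > 0" "cball (snd c p) (2 * r) \<subseteq> chart_image c"
      by (rule exists_chart_ball)
    from nodal_max_chart_estimate[OF c(1,3,4)] chart_l1_bound[OF c(1) compact_cball c(4)]
    obtain C m D where "est c (snd c p) r C m D"
      unfolding est_def using c by blast
    moreover have "p \<in> chart_inv c ` ball (snd c p) r"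
      using chart_facts(6)[OF c(1,2)] c(3) by (metis centre_in_ball imageI)
    ultimately show "p \<in> \<Union>\<N>" unfolding \<N>_def by blast
  qed
  ultimately obtain \<D> where \<D>: "\<D> \<subseteq> \<N>" "finite \<D>" "M \<subseteq> \<Union>\<D>"
    using \<open>compact M\<close>[unfolded compact_eq_openin_cover] by meson
  have "\<forall>N\<in>\<D>. \<exists>c y r C m D. est c y r C m D \<and> N = chart_inv c ` ball y r"
    using \<D>(1) unfolding \<N>_def by blast
  then obtain c y r C m D where est: "\<And>N. N \<in> \<D> \<Longrightarrow> est (c N) (y N) (r N) (C N) (m N) (D N)"
    and N: "\<And>N. N \<in> \<D> \<Longrightarrow> N = chart_inv (c N) ` ball (y N) (r N)"
    by metis
  \<comment> \<open>Sums of positive constants dominate each of them and make sense for an empty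
    cover too; the added 1 ensures positivity.\<close>
  define \<mu>0 where "\<mu>0 = 1 + (\<Sum>N\<in>\<D>. m N)"
  define C0 where "C0 = 1 + (\<Sum>N\<in>\<D>. C N)"
  define k where "k = C0 * (\<Sum>N\<in>\<D>. D N) + 1"
  have pos: "C N > 0" "m N > 0" "D N \<ge> 0" "c N \<in> \<A>" "cball (y N) (2 * r N) \<subseteq> chart_image (c N)" if "N \<in> \<D>" for N
    using est[OF that] by (auto simp: est_def)
  have C0: "C0 > 0" unfolding C0_def using pos by (intro add_pos_nonneg sum_nonneg) (auto intro: less_imp_le)
  have CC0: "C N \<le> C0" if "N \<in> \<D>" for N
    unfolding C0_def using member_le_sum[OF that, of C] pos \<D>(2) by (force intro: less_imp_le)
  have m\<mu>0: "m N \<le> \<mu>0" if "N \<in> \<D>" for N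
    unfolding \<mu>0_def using member_le_sum[OF that, of m] pos \<D>(2) by (force intro: less_imp_le)
  have \<mu>0: "\<mu>0 > 0" unfolding \<mu>0_def using pos by (intro add_pos_nonneg sum_nonneg) (auto intro: less_imp_le)
  have k: "k > 0" unfolding k_def using C0 pos by (intro add_nonneg_pos mult_nonneg_nonneg sum_nonneg) auto
  show ?thesis
  proof (rule exI, rule conjI[OF \<mu>0], rule exI, rule conjI[OF k], intro allI impI, elim conjE)
    fix \<mu> u assume \<mu>: "\<mu>0 \<le> \<mu>" and u: "eigenfunction M \<A> g \<mu> u" "l2_norm (riemannian_volume M \<A> g) u = 1"
    define s where "s = \<mu> powr (real CARD('n) / 2)"
    have s: "s \<ge> 0" by (simp add: s_def)
    have su: "smooth_function \<A> u" using u(1) by (simp add: eigenfunction_def)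
    note cu = smooth_function_continuous_on[OF su]
    define T where "T N A = snd (c N) ` (A \<inter> fst (c N))" for N A
    define K where "K N = cball (y N) (2 * r N)" for N
    define f where "f N x = \<bar>u (chart_inv (c N) x)\<bar>" for N x
    have cf: "continuous_on (K N) (f N)" if "N \<in> \<D>" for N
      unfolding f_def
      by (intro continuous_intros continuous_on_compose2[OF cu continuous_on_subset[OF chart_facts(9)[OF pos(4)[OF that]]]])
         (use pos[OF that] chart_facts(3,7)[OF pos(4)[OF that]] in \<open>auto simp: K_def\<close>)
    have oT: "open (T N A)" if "N \<in> \<D>" "A \<in> nodal_domains M u" for N A
      unfolding T_def by (rule open_chart_restriction[OF pos(4)[OF that(1)] nodal_domain_facts(2)[OF that(2)]])
    have dT: "disjoint_family_on (T N) \<F>" if "N \<in> \<D>" "\<F> \<subseteq> nodal_domains M u" for N \<F>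
    proof (unfold disjoint_family_on_def, intro ballI impI)
      fix A B assume AB: "A \<in> \<F>" "B \<in> \<F>" "A \<noteq> B"
      then have "A \<inter> B = {}" using nodal_domains_disjoint[of A u B] that(2) by blast
      moreover have "inj_on (snd (c N)) (fst (c N))"
        by (rule inj_on_inverseI[where g="chart_inv (c N)"]) (rule chart_facts(6)[OF pos(4)[OF that(1)]])
      ultimately show "T N A \<inter> T N B = {}"
        unfolding T_def by (auto dest: inj_onD)
    qed
    \<comment> \<open>Which piece contains the maximum point depends on \<open>A\<close>. Adding the
      nonnegative integrals over all pieces removes this dependence, so that the order of summation
      can be exchanged later.\<close>
    have key: "\<exists>a>0. nodal_max u A = a \<and> (\<forall>q\<in>A. \<bar>u q\<bar> \<le> a) \<and>
        a \<le> C0 * s * (\<Sum>N\<in>\<D>. LINT x:T N A \<inter> K N|lborel. f N x)" if A: "A \<in> nodal_domains M u" for A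
    proof -
      obtain p where p: "p \<in> A" "\<And>q. q \<in> A \<Longrightarrow> \<bar>u q\<bar> \<le> \<bar>u p\<bar>"
        using nodal_domain_max[OF \<open>compact M\<close> cu A] by blast
      have up: "\<bar>u p\<bar> > 0" using nodal_domain_facts(5)[OF A p(1)] by simp
      have "nodal_max u A = \<bar>u p\<bar>"
        unfolding nodal_max_def by (rule cSup_eq_maximum) (use p in auto)
      moreover have "\<bar>u p\<bar> \<le> C0 * s * (\<Sum>N\<in>\<D>. LINT x:T N A \<inter> K N|lborel. f N x)"
      proof -
        have "p \<in> M" using nodal_domain_facts(4)[OF A] p(1) by blast
        then obtain N where N1: "N \<in> \<D>" "p \<in> N" using \<D>(3) by blast
        then obtain z where z: "z \<in> ball (y N) (r N)" "p = chart_inv (c N) z" using N[OF N1(1)] by blast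
        have "r N > 0" using z(1) by (smt (verit) mem_ball zero_le_dist)
        then have zc: "z \<in> chart_image (c N)" using z(1) pos(5)[OF N1(1)] by auto
        have pz: "p \<in> fst (c N)" "snd (c N) p = z"
          using z(2) chart_facts(7,8)[OF pos(4)[OF N1(1)] zc] by auto
        have I0: "0 \<le> (LINT x:T N A \<inter> K N|lborel. f N x)" for N
          by (simp add: set_lebesgue_integral_def f_def)
        have "\<bar>u p\<bar> \<le> C N * s * (LINT x:T N A \<inter> K N|lborel. f N x)"
          using est[OF N1(1)] order_trans[OF m\<mu>0[OF N1(1)] \<mu>] u(1) A p pz z(1)
          unfolding est_def T_def K_def f_def s_def by (auto simp: less_imp_le)
        also have "\<dots> \<le> C0 * s * (\<Sum>N\<in>\<D>. LINT x:T N A \<inter> K N|lborel. f N x)"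
          using CC0[OF N1(1)] C0 s I0 member_le_sum[OF N1(1), of "\<lambda>N. LINT x:T N A \<inter> K N|lborel. f N x"] \<D>(2)
          by (intro mult_mono) auto
        finally show ?thesis .
      qed
      ultimately show ?thesis using up p(2) by blast
    qed
    \<comment> \<open>Replacing \<open>\<bar>u\<bar>\<close> on \<open>A\<close> by its maximum and
      cancelling the maximum shows that the total coordinate measure of \<open>A\<close> in the
      pieces is at least \<open>1 / (C0 * s)\<close>. Disjoint sets of this size fit only finitely
      often.\<close>
    have card: "real (card \<F>) \<le> C0 * s * (\<Sum>N\<in>\<D>. LINT x:K N|lborel. 1)"
      if \<F>: "\<F> \<subseteq> nodal_domains M u" "finite \<F>" for \<F>
    proof -
      have "1 \<le> C0 * s * (\<Sum>N\<in>\<D>. LINT x:T N A \<inter> K N|lborel. 1)" if A: "A \<in> \<F>" for A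
      proof -
        have And: "A \<in> nodal_domains M u" using A \<F>(1) by blast
        from key[OF this] obtain a where a: "a > 0" "\<forall>q\<in>A. \<bar>u q\<bar> \<le> a"
          "a \<le> C0 * s * (\<Sum>N\<in>\<D>. LINT x:T N A \<inter> K N|lborel. f N x)" by blast
        have "(LINT x:T N A \<inter> K N|lborel. f N x) \<le> a * (LINT x:T N A \<inter> K N|lborel. 1)" if N1: "N \<in> \<D>" for N
        proof -
          have i: "integrable lborel (\<lambda>x. indicator (T N A \<inter> K N) x *\<^sub>R h x)" if "continuous_on (K N) h" for h :: "real^'n \<Rightarrow> real"
          proof -
            have "integrable lborel (\<lambda>x. indicator (K N) x *\<^sub>R h x)"
              by (rule borel_integrable_compact[OF _ that]) (simp add: K_def)
            then have "integrable lborel (\<lambda>x. indicator (T N A) x *\<^sub>R indicator (K N) x *\<^sub>R h x)"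
              by (rule integrable_mult_indicator[rotated]) (use oT[OF N1 And] in simp)
            then show ?thesis by (simp add: indicator_inter_arith mult.assoc)
          qed
          have "(LINT x:T N A \<inter> K N|lborel. f N x) \<le> (\<integral>x. a * (indicator (T N A \<inter> K N) x *\<^sub>R 1) \<partial>lborel)"
            unfolding set_lebesgue_integral_def
          proof (rule integral_mono[OF i[OF cf[OF N1]]])
            show "integrable lborel (\<lambda>x. a * (indicator (T N A \<inter> K N) x *\<^sub>R 1))"
              using i[OF continuous_on_const, of 1] by simp
            show "indicator (T N A \<inter> K N) x *\<^sub>R f N x \<le> a * (indicator (T N A \<inter> K N) x *\<^sub>R 1)" for x
              using a(2) chart_facts(6)[OF pos(4)[OF N1]] by (auto simp: indicator_def f_def T_def)
          qed
          then show ?thesis by (simp add: set_lebesgue_integral_def)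
        qed
        then have "(\<Sum>N\<in>\<D>. LINT x:T N A \<inter> K N|lborel. f N x) \<le> (\<Sum>N\<in>\<D>. a * (LINT x:T N A \<inter> K N|lborel. 1))"
          by (rule sum_mono)
        then have "C0 * s * (\<Sum>N\<in>\<D>. LINT x:T N A \<inter> K N|lborel. f N x) \<le> C0 * s * (a * (\<Sum>N\<in>\<D>. LINT x:T N A \<inter> K N|lborel. 1))"
          using C0 s unfolding sum_distrib_left[symmetric] by (intro mult_left_mono) auto
        then have "a * 1 \<le> a * (C0 * s * (\<Sum>N\<in>\<D>. LINT x:T N A \<inter> K N|lborel. 1))"
          using a(3) by (simp add: mult_ac)
        then show ?thesis using a(1) by (rule mult_left_le_imp_le)
      qed
      then have "real (card \<F>) \<le> (\<Sum>A\<in>\<F>. C0 * s * (\<Sum>N\<in>\<D>. LINT x:T N A \<inter> K N|lborel. 1))"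
        using sum_mono[of \<F> "\<lambda>_. 1::real"] by simp
      also have "\<dots> = C0 * s * (\<Sum>N\<in>\<D>. \<Sum>A\<in>\<F>. LINT x:T N A \<inter> K N|lborel. 1)"
        by (simp only: sum_distrib_left[symmetric] sum.swap[of _ \<F>])
      also have "\<dots> \<le> C0 * s * (\<Sum>N\<in>\<D>. LINT x:K N|lborel. 1)"
        using C0 s \<F> oT dT
        by (intro mult_left_mono sum_mono sum_set_integral_disjoint_le) (auto simp: K_def)
      finally show ?thesis .
    qed
    \<comment> \<open>A common bound for the cardinality of all finite subfamilies suffices.
      Finiteness has to precede the estimate of the sum, since a \<open>sum\<close> over an infinite
      set is 0 by convention.\<close>
    have fin: "finite (nodal_domains M u)"
    proof (rule conjunct1[OF finite_if_finite_subsets_card_bdd])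
      fix \<F> assume "\<F> \<subseteq> nodal_domains M u" "finite \<F>"
      from card[OF this] show "card \<F> \<le> nat \<lfloor>C0 * s * (\<Sum>N\<in>\<D>. LINT x:K N|lborel. 1)\<rfloor>"
        by linarith
    qed
    have "(\<Sum>A\<in>nodal_domains M u. nodal_max u A) \<le>
        (\<Sum>A\<in>nodal_domains M u. C0 * s * (\<Sum>N\<in>\<D>. LINT x:T N A \<inter> K N|lborel. f N x))"
      using key by (intro sum_mono) blast
    also have "\<dots> = C0 * s * (\<Sum>N\<in>\<D>. \<Sum>A\<in>nodal_domains M u. LINT x:T N A \<inter> K N|lborel. f N x)"
      by (simp only: sum_distrib_left[symmetric] sum.swap[of _ "nodal_domains M u"])
    also have "\<dots> \<le> C0 * s * (\<Sum>N\<in>\<D>. D N)"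
    proof (intro mult_left_mono sum_mono)
      fix N assume N1: "N \<in> \<D>"
      have "(\<Sum>A\<in>nodal_domains M u. LINT x:T N A \<inter> K N|lborel. f N x) \<le> (LINT x:K N|lborel. f N x)"
        using fin oT[OF N1] dT[OF N1] cf[OF N1]
        by (intro sum_set_integral_disjoint_le) (auto simp: K_def f_def)
      also have "\<dots> \<le> D N"
        using est[OF N1] su u(2) unfolding est_def K_def f_def by blast
      finally show "(\<Sum>A\<in>nodal_domains M u. LINT x:T N A \<inter> K N|lborel. f N x) \<le> D N" .
    qed (use C0 s in simp)
    also have "\<dots> \<le> k * s"
      using s by (simp add: k_def algebra_simps)
    finally show "finite (nodal_domains M u) \<and>
      (\<Sum>A\<in>nodal_domains M u. nodal_max u A) \<le> k * \<mu> powr (real CARD('n) / 2)"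
      using fin by (simp add: s_def)
  qed
qed

end
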